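(* Let $n\ge1$ and let $\mathfrak b$ be a Borel subalgebra of $\mathfrak{sp}(2n,\mathbb C)$. For every integer $i\ge 0$, the number of abelian ideals of $\mathfrak b$ of dimension $i$ is equal to the coefficient of $t^i$ in the polynomial $\prod_{j=1}^n(1+t^j)$.
   Context: An abelian ideal of $\mathfrak b$ is an ideal $I$ of the Lie algebra $\mathfrak b$ with $[I,I]=0$; the zero ideal is included. *)

theory Defs
  imports "HOL-Analysis.Analysis" "HOL-Computational_Algebra.Polynomial"
begin

definition matrix_scale :: "complex \<Rightarrow> complex ^ 'n ^ 'm \<Rightarrow> complex ^ 'n ^ 'm" where
  "matrix_scale c A = (\<chi> i j. c * A $ i $ j)"

(* Subspaces, spans and dimensions of sets of complex matrices are taken over the complex
   numbers; the unqualified subspace, span and dim would be over the reals. *)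
global_interpretation cmat: vector_space
  "matrix_scale :: complex \<Rightarrow> complex ^ 'n ^ 'm \<Rightarrow> complex ^ 'n ^ 'm"
  by unfold_locales (simp_all add: matrix_scale_def vec_eq_iff algebra_simps)

definition lie_bracket :: "complex ^ 'm ^ 'm \<Rightarrow> complex ^ 'm ^ 'm \<Rightarrow> complex ^ 'm ^ 'm" where
  "lie_bracket X Y = X ** Y - Y ** X"

definition lie_subalgebra :: "(complex ^ 'm ^ 'm) set \<Rightarrow> (complex ^ 'm ^ 'm) set \<Rightarrow> bool" where
  "lie_subalgebra K L \<longleftrightarrow>
     cmat.subspace K \<and> K \<subseteq> L \<and> (\<forall>X\<in>K. \<forall>Y\<in>K. lie_bracket X Y \<in> K)"

definition lie_ideal :: "(complex ^ 'm ^ 'm) set \<Rightarrow> (complex ^ 'm ^ 'm) set \<Rightarrow> bool" where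
  "lie_ideal I L \<longleftrightarrow>
     cmat.subspace I \<and> I \<subseteq> L \<and> (\<forall>X\<in>L. \<forall>Y\<in>I. lie_bracket X Y \<in> I)"

definition bracket_space ::
    "(complex ^ 'm ^ 'm) set \<Rightarrow> (complex ^ 'm ^ 'm) set \<Rightarrow> (complex ^ 'm ^ 'm) set" where
  "bracket_space K L = cmat.span {lie_bracket X Y | X Y. X \<in> K \<and> Y \<in> L}"

primrec derived_series :: "(complex ^ 'm ^ 'm) set \<Rightarrow> nat \<Rightarrow> (complex ^ 'm ^ 'm) set" where
  "derived_series L 0 = L"
| "derived_series L (Suc k) = bracket_space (derived_series L k) (derived_series L k)"

definition lie_solvable :: "(complex ^ 'm ^ 'm) set \<Rightarrow> bool" where
  "lie_solvable L \<longleftrightarrow> (\<exists>k. derived_series L k = {0})"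

definition borel_subalgebra :: "(complex ^ 'm ^ 'm) set \<Rightarrow> (complex ^ 'm ^ 'm) set \<Rightarrow> bool" where
  "borel_subalgebra B L \<longleftrightarrow>
     lie_subalgebra B L \<and> lie_solvable B \<and>
     (\<forall>C. lie_subalgebra C L \<and> lie_solvable C \<and> B \<subseteq> C \<longrightarrow> C = B)"

definition abelian_ideal :: "(complex ^ 'm ^ 'm) set \<Rightarrow> (complex ^ 'm ^ 'm) set \<Rightarrow> bool" where
  "abelian_ideal I L \<longleftrightarrow> lie_ideal I L \<and> (\<forall>X\<in>I. \<forall>Y\<in>I. lie_bracket X Y = 0)"

(* The block matrix ((0, 1), (-1, 0)). The index type 'n + 'n has 2n elements for n = CARD('n). *)
definition symplectic_form :: "complex ^ ('n::finite + 'n) ^ ('n + 'n)" where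
  "symplectic_form = (\<chi> i j. case (i, j) of
       (Inl a, Inr b) \<Rightarrow> (if a = b then 1 else 0)
     | (Inr a, Inl b) \<Rightarrow> (if a = b then - 1 else 0)
     | _ \<Rightarrow> 0)"

definition sp_algebra :: "(complex ^ ('n::finite + 'n) ^ ('n + 'n)) set" where
  "sp_algebra = {X. transpose X ** symplectic_form + symplectic_form ** X = 0}"

end

theory Submission
  imports Defs "HOL-Computational_Algebra.Fundamental_Theorem_Algebra"
begin

text \<open>
  Lie's theorem, applied again and again to \<open>W\<^sup>\<bottom> / W\<close> for an isotropic invariant subspace
  \<open>W\<close>, makes a solvable subalgebra of the symplectic algebra stabilise a complete isotropic flag
  (\<open>exists_isotropic_flag\<close>). A basis adapted to the flag extends to a symplectic basis
  (\<open>exists_symplectic_extension\<close>), and the stabiliser of the flag is itself solvable; a maximal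
  solvable subalgebra is therefore conjugate, by a symplectic matrix, to the algebra of matrices with
  blocks \<open>(A, S; 0, - A\<^sup>T)\<close>, with \<open>A\<close> upper triangular and \<open>S\<close>
  symmetric (\<open>borel_conjugate\<close>). Conjugation preserves abelian ideals and dimensions.

  In an abelian ideal of this algebra all diagonal blocks \<open>A\<close> vanish
  (\<open>abelian_ideal_diagonal_block\<close>), so that the ideal is a space of symmetric matrices stable under
  \<open>S \<mapsto> A S + S A\<^sup>T\<close> for upper triangular \<open>A\<close>. The diagonal \<open>A\<close> split it
  into weight spaces, all of dimension one, and the elementary \<open>A\<close> move a nonzero entry to smaller
  row and column indices. The abelian ideals are thus the spaces of symmetric matrices supported on a
  symmetric down-set of the square \<open>n \<times> n\<close>, and the dimension is the number of cells on or above
  the diagonal (\<open>abelian_ideals_std_borel\<close>, \<open>dim_radical_ideal\<close>).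

  A symmetric down-set of the square of side \<open>n + 1\<close> either avoids the last row and column, and lives
  in the square of side \<open>n\<close>, or contains the whole first row and column; removing these leaves an
  arbitrary symmetric down-set of the square of side \<open>n\<close> and loses \<open>n + 1\<close> cells on or above
  the diagonal. The generating function is therefore multiplied by \<open>1 + t\<^bsup>n+1\<^esup>\<close>
  (\<open>sum_weight_sym_downsets\<close>).
\<close>


section \<open>Lie's theorem relative to a pair of invariant subspaces\<close>

definition matrix_unit :: "'m \<Rightarrow> 'k \<Rightarrow> complex ^ 'k ^ 'm" where
  "matrix_unit i j = (\<chi> a b. if a = i \<and> b = j then 1 else 0)"

lemma matrix_unit_expansion:
  fixes X :: "complex ^ 'k::finite ^ 'm::finite"
  shows "X = (\<Sum>p\<in>UNIV. matrix_scale (X $ fst p $ snd p) (matrix_unit (fst p) (snd p)))"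
proof -
  have "(\<Sum>p\<in>UNIV. matrix_scale (X $ fst p $ snd p) (matrix_unit (fst p) (snd p))) $ a $ b = X $ a $ b" for a b
  proof -
    have "(\<Sum>p\<in>UNIV. matrix_scale (X $ fst p $ snd p) (matrix_unit (fst p) (snd p))) $ a $ b
        = (\<Sum>p\<in>UNIV. if p = (a, b) then X $ a $ b else 0)"
      unfolding sum_component
      by (rule sum.cong) (auto simp: matrix_scale_def matrix_unit_def)
    then show ?thesis by simp
  qed
  then show ?thesis by (simp add: vec_eq_iff)
qed

text \<open>
  Any basis is finite, because the matrix units span.
\<close>
interpretation cmat: finite_dimensional_vector_space
  "matrix_scale :: complex \<Rightarrow> complex ^ 'k::finite ^ 'm::finite \<Rightarrow> complex ^ 'k ^ 'm"
  "cmat.extend_basis {}"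
proof
  let ?U = "range (\<lambda>p. matrix_unit (fst p) (snd p)) :: (complex ^ 'k ^ 'm) set"
  have sp: "cmat.span ?U = UNIV"
  proof -
    have "X \<in> cmat.span ?U" for X :: "complex ^ 'k ^ 'm"
      by (subst matrix_unit_expansion) (intro cmat.span_sum cmat.span_scale cmat.span_base rangeI)
    then show ?thesis by blast
  qed
  show ind: "cmat.independent (cmat.extend_basis {} :: (complex ^ 'k ^ 'm) set)"
    by (rule cmat.independent_extend_basis) (rule cmat.independent_empty)
  show "cmat.span (cmat.extend_basis {} :: (complex ^ 'k ^ 'm) set) = UNIV"
    by (rule cmat.span_extend_basis) (rule cmat.independent_empty)
  show "finite (cmat.extend_basis {} :: (complex ^ 'k ^ 'm) set)"
    by (rule conjunct1[OF cmat.independent_span_bound[OF _ ind, of ?U]]) (simp_all add: sp)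
qed

lemma exists_krylov_relation:
  fixes v :: "nat \<Rightarrow> complex ^ 'm"
  shows "\<exists>m. v m \<in> vec.span (W \<union> v ` {..<m})"
proof (rule ccontr)
  assume *: "\<nexists>m. v m \<in> vec.span (W \<union> v ` {..<m})"
  have "m \<le> vec.dim (W \<union> v ` {..<m})" for m
  proof (induction m)
    case (Suc m)
    have "W \<union> v ` {..<Suc m} = insert (v m) (W \<union> v ` {..<m})"
      by (auto simp: lessThan_Suc)
    then have "vec.dim (W \<union> v ` {..<Suc m}) = vec.dim (W \<union> v ` {..<m}) + 1"
      using * by (simp add: vec.dim_insert del: Un_insert_right)
    with Suc show ?case by simp
  qed simp
  from this[of "Suc (CARD('m))"] show False
    using vec.dim_subset_UNIV[of "W \<union> v ` {..<Suc (CARD('m))}"] by (simp add: vec.dimension_def card_cart_basis)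
qed


text \<open>
  The vector \<open>p(X) u\<close>, evaluated by Horner's scheme.
\<close>
definition poly_apply :: "complex ^ 'm ^ 'm \<Rightarrow> complex ^ 'm \<Rightarrow> complex poly \<Rightarrow> complex ^ 'm" where
  "poly_apply X u p = fold_coeffs (\<lambda>a w. a *s u + X *v w) p 0"

lemma poly_apply_0 [simp]: "poly_apply X u 0 = 0"
  by (simp add: poly_apply_def)

lemma poly_apply_pCons [simp]: "poly_apply X u (pCons a p) = a *s u + X *v poly_apply X u p"
  by (cases "p = 0 \<and> a = 0") (auto simp: poly_apply_def)

lemma poly_apply_add: "poly_apply X u (p + q) = poly_apply X u p + poly_apply X u q"
  by (induction p q rule: poly_induct2) (simp_all add: algebra_simps vec.scale_left_distrib)

lemma poly_apply_smult: "poly_apply X u (smult c p) = c *s poly_apply X u p"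
  by (induction p) (simp_all add: algebra_simps vec.scale_right_distrib vector_scalar_commute)

lemma poly_apply_monom: "poly_apply X u (monom 1 k) = (((*v) X) ^^ k) u"
  by (induction k) (simp_all add: monom_Suc monom_0 one_pCons)

text \<open>
  A relation that expresses \<open>X\<^sup>m u\<close> through lower powers modulo \<open>W\<close> is a monic polynomial
  in \<open>X\<close>.
\<close>
lemma exists_annihilating_poly:
  fixes W :: "(complex ^ 'm) set"
  assumes W: "vec.subspace W"
  shows "\<exists>p. p \<noteq> 0 \<and> poly_apply X u p \<in> W"
proof -
  define v where "v k = (((*v) X) ^^ k) u" for k
  obtain m where m: "v m \<in> vec.span (W \<union> v ` {..<m})"
    using exists_krylov_relation by blast
  let ?R = "{x. \<exists>p. (\<forall>i\<ge>m. coeff p i = 0) \<and> x - poly_apply X u p \<in> W}"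
  have "vec.subspace ?R"
  proof (rule vec.subspaceI)
    show "0 \<in> ?R" by (auto intro!: exI[of _ 0] simp: vec.subspace_0[OF W])
  next
    fix x y assume "x \<in> ?R" "y \<in> ?R"
    then obtain p q where pq: "\<forall>i\<ge>m. coeff p i = 0" "x - poly_apply X u p \<in> W"
      "\<forall>i\<ge>m. coeff q i = 0" "y - poly_apply X u q \<in> W" by blast
    have "x + y - poly_apply X u (p + q) \<in> W"
      using vec.subspace_add[OF W pq(2,4)] by (simp add: poly_apply_add algebra_simps)
    with pq show "x + y \<in> ?R" by (auto intro!: exI[of _ "p + q"])
  next
    fix c x assume "x \<in> ?R"
    then obtain p where p: "\<forall>i\<ge>m. coeff p i = 0" "x - poly_apply X u p \<in> W" by blast
    have "c *s x - poly_apply X u (smult c p) \<in> W"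
      using vec.subspace_scale[OF W p(2), of c]
      by (simp add: poly_apply_smult vec.scale_right_diff_distrib)
    with p show "c *s x \<in> ?R" by (auto intro!: exI[of _ "smult c p"])
  qed
  moreover have "W \<union> v ` {..<m} \<subseteq> ?R"
  proof
    fix x assume "x \<in> W \<union> v ` {..<m}"
    then consider "x \<in> W" | k where "k < m" "x = v k" by blast
    then show "x \<in> ?R"
    proof cases
      case 1
      then show ?thesis by (auto intro!: exI[of _ 0])
    next
      case 2
      then show ?thesis
        by (auto intro!: exI[of _ "monom 1 k"] simp: v_def poly_apply_monom vec.subspace_0[OF W])
    qed
  qed
  ultimately have "v m \<in> ?R"
    using m vec.span_minimal by blast
  then obtain p where p: "\<forall>i\<ge>m. coeff p i = 0" "v m - poly_apply X u p \<in> W" by blast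
  have "poly_apply X u (monom 1 m + smult (-1) p) \<in> W"
    using p(2) unfolding poly_apply_add poly_apply_smult by (simp add: poly_apply_monom v_def)
  moreover have "coeff (monom 1 m + smult (-1) p) m = 1"
    using p(1) by simp
  then have "monom 1 m + smult (-1) p \<noteq> 0" by (metis coeff_0 zero_neq_one)
  ultimately show ?thesis by blast
qed

text \<open>
  Take \<open>p\<close> of least degree with \<open>p(X) u \<in> W\<close> and divide it by a linear factor: the
  quotient sends \<open>u\<close> to an eigenvector modulo \<open>W\<close>.
\<close>
lemma exists_eigenvector_mod:
  fixes W V :: "(complex ^ 'm) set"
  assumes W: "vec.subspace W" and V: "vec.subspace V"
    and XV: "\<And>x. x \<in> V \<Longrightarrow> X *v x \<in> V"
    and u: "u \<in> V" "u \<notin> W"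
  shows "\<exists>v \<mu>. v \<in> V \<and> v \<notin> W \<and> X *v v - \<mu> *s v \<in> W"
proof -
  define P where "P p \<longleftrightarrow> p \<noteq> 0 \<and> poly_apply X u p \<in> W" for p
  obtain p where p: "P p" and min: "\<And>q. degree q < degree p \<Longrightarrow> \<not> P q"
    using exists_annihilating_poly[OF W, of X u] ex_has_least_nat[of P _ degree]
    unfolding P_def by (metis not_le)
  have inV: "poly_apply X u q \<in> V" for q
    by (induction q) (auto intro!: vec.subspace_0 vec.subspace_add vec.subspace_scale V u XV)
  have "\<not> constant (poly p)"
  proof
    assume "constant (poly p)"
    then have "degree p = 0" by (simp add: constant_degree)
    then obtain a where a: "p = [:a:]" by (meson degree_eq_zeroE)
    with p have "a \<noteq> 0" "a *s u \<in> W" by (auto simp: P_def)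
    then have "inverse a *s (a *s u) \<in> W" using vec.subspace_scale[OF W] by blast
    with \<open>a \<noteq> 0\<close> u show False by simp
  qed
  then obtain \<mu> where "poly p \<mu> = 0" using fundamental_theorem_of_algebra by blast
  then obtain q where q: "p = [:-\<mu>, 1:] * q" using poly_eq_0_iff_dvd by (metis dvdE)
  have q0: "q \<noteq> 0" using p q by (auto simp: P_def)
  have "degree p = Suc (degree q)"
    unfolding q by (subst degree_mult_eq) (use q0 in auto)
  then have "poly_apply X u q \<notin> W" using min[of q] q0 by (simp add: P_def)
  moreover have "p = smult (-\<mu>) q + pCons 0 q" unfolding q by simp
  then have "poly_apply X u p = (-\<mu>) *s poly_apply X u q + X *v poly_apply X u q"
    by (simp only: poly_apply_add poly_apply_smult poly_apply_pCons) simp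
  then have "X *v poly_apply X u q - \<mu> *s poly_apply X u q \<in> W"
    using p by (simp add: P_def)
  ultimately show ?thesis using inV by blast
qed

lemma mat_vector_mult: "mat c *v x = c *s (x :: complex ^ 'm)"
  by (simp add: vec_eq_iff matrix_vector_mult_def mat_def if_distrib if_distribR sum.delta cong: if_cong)

text \<open>
  This is the step of Lie's theorem that usually appeals to the trace of a commutator. The following
  argument without traces works modulo \<open>W\<close> as it stands. With \<open>v\<^sub>k = X\<^sup>k u\<close> and \<open>S\<^sub>k\<close> the span of
  \<open>W\<close> and the \<open>v\<^sub>j\<close> with \<open>j < k\<close>, the matrix \<open>Y - \<nu>(Y)\<close> lowers the filtration, and its
  leading coefficient is explicit:
  \<open>(Y - \<nu>(Y)) v\<^bsub>k+1\<^esub> \<equiv> - (k + 1) \<nu>([X, Y]) v\<^sub>k\<close> modulo \<open>S\<^sub>k\<close>. At the first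
  \<open>k\<close> with \<open>v\<^bsub>k+1\<^esub> \<in> S\<^bsub>k+1\<^esub>\<close> the left side lies in \<open>S\<^sub>k\<close>, whereas \<open>v\<^sub>k\<close>
  does not, which forces the coefficient to vanish.
\<close>
lemma weight_vanishes_on_bracket:
  fixes W :: "(complex ^ 'm) set" and \<nu> :: "complex ^ 'm ^ 'm \<Rightarrow> complex"
  assumes W: "vec.subspace W"
    and XW: "\<And>x. x \<in> W \<Longrightarrow> X *v x \<in> W"
    and MW: "\<And>Y x. Y \<in> M \<Longrightarrow> x \<in> W \<Longrightarrow> Y *v x \<in> W"
    and br: "\<And>Y. Y \<in> M \<Longrightarrow> lie_bracket X Y \<in> M"
    and u: "u \<notin> W"
    and wt: "\<And>Y. Y \<in> M \<Longrightarrow> Y *v u - \<nu> Y *s u \<in> W"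
    and Y: "Y \<in> M"
  shows "\<nu> (lie_bracket X Y) = 0"
proof -
  define v where "v k = (((*v) X) ^^ k) u" for k
  define S where "S k = vec.span (W \<union> v ` {..<k})" for k
  have v0: "v 0 = u" and vS: "v (Suc k) = X *v v k" for k by (simp_all add: v_def)
  have sub: "vec.subspace (S k)" for k by (simp add: S_def)
  have WS: "x \<in> S k" if "x \<in> W" for x k using that by (auto simp: S_def intro: vec.span_base)
  have S0: "S 0 = W" using W by (simp add: S_def)
  have vinS: "v j \<in> S k" if "j < k" for j k using that by (auto simp: S_def intro: vec.span_base)
  have mono: "S j \<subseteq> S k" if "j \<le> k" for j k
    unfolding S_def using that by (intro vec.span_mono) auto
  have mapS: "A *v x \<in> T" if "vec.subspace T" "\<And>x. x \<in> W \<Longrightarrow> A *v x \<in> T"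
    "\<And>j. j < k \<Longrightarrow> A *v v j \<in> T" "x \<in> S k" for A T x k
  proof -
    have "vec.subspace {x. A *v x \<in> T}"
      using that(1) by (auto intro!: vec.subspaceI simp: vec.subspace_0 vec.subspace_add
        vec.subspace_scale matrix_vector_right_distrib vector_scalar_commute)
    moreover have "W \<union> v ` {..<k} \<subseteq> {x. A *v x \<in> T}" using that by auto
    ultimately show ?thesis using that(4) vec.span_minimal unfolding S_def by blast
  qed
  have XS: "X *v x \<in> S (Suc k)" if "x \<in> S k" for x k
    by (rule mapS[OF sub _ _ that]) (auto intro: WS XW vinS simp flip: vS)
  have comm: "Y *v v (Suc k) = X *v (Y *v v k) - lie_bracket X Y *v v k" for Y k
    by (simp add: vS lie_bracket_def matrix_vector_mul_assoc matrix_vector_mult_diff_rdistrib)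
  have a: "\<forall>Y\<in>M. Y *v v k - \<nu> Y *s v k \<in> S k" for k
  proof (induction k)
    case 0
    then show ?case using wt by (simp add: v0 S0)
  next
    case (Suc k)
    show ?case
    proof
      fix Y assume Y: "Y \<in> M"
      let ?Z = "lie_bracket X Y"
      have "X *v (Y *v v k - \<nu> Y *s v k) \<in> S (Suc k)" using Suc Y XS by blast
      moreover have "?Z *v v k - \<nu> ?Z *s v k \<in> S (Suc k)"
        using Suc br[OF Y] mono[of k "Suc k"] by auto
      moreover have "\<nu> ?Z *s v k \<in> S (Suc k)" by (intro vec.subspace_scale sub vinS) simp
      moreover have "Y *v v (Suc k) - \<nu> Y *s v (Suc k) =
          X *v (Y *v v k - \<nu> Y *s v k) - (?Z *v v k - \<nu> ?Z *s v k) - \<nu> ?Z *s v k"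
        by (simp add: comm) (simp add: vS matrix_vector_mult_diff_distrib vector_scalar_commute)
      ultimately show "Y *v v (Suc k) - \<nu> Y *s v (Suc k) \<in> S (Suc k)"
        using vec.subspace_diff[OF sub] by metis
    qed
  qed
  have b: "Y *v v (Suc k) - \<nu> Y *s v (Suc k) + (of_nat (Suc k) * \<nu> (lie_bracket X Y)) *s v k \<in> S k" for k
  proof (induction k)
    case 0
    let ?Z = "lie_bracket X Y"
    have "X *v (Y *v v 0 - \<nu> Y *s v 0) - (?Z *v v 0 - \<nu> ?Z *s v 0) \<in> S 0"
    proof (rule vec.subspace_diff[OF sub])
      show "X *v (Y *v v 0 - \<nu> Y *s v 0) \<in> S 0" using a[of 0] Y XW unfolding S0 by blast
      show "?Z *v v 0 - \<nu> ?Z *s v 0 \<in> S 0" using a br[OF Y] by blast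
    qed
    then show ?case
      by (simp add: comm) (simp add: vS matrix_vector_mult_diff_distrib vector_scalar_commute algebra_simps)
  next
    case (Suc k)
    let ?Z = "lie_bracket X Y"
    have "X *v (Y *v v (Suc k) - \<nu> Y *s v (Suc k) + (of_nat (Suc k) * \<nu> ?Z) *s v k) \<in> S (Suc k)"
      using Suc XS by blast
    moreover have "?Z *v v (Suc k) - \<nu> ?Z *s v (Suc k) \<in> S (Suc k)"
      using a br[OF Y] by blast
    moreover have "Y *v v (Suc (Suc k)) - \<nu> Y *s v (Suc (Suc k)) + (of_nat (Suc (Suc k)) * \<nu> ?Z) *s v (Suc k)
       = X *v (Y *v v (Suc k) - \<nu> Y *s v (Suc k) + (of_nat (Suc k) * \<nu> ?Z) *s v k)
         - (?Z *v v (Suc k) - \<nu> ?Z *s v (Suc k))"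
    proof -
      have "(of_nat (Suc (Suc k)) * \<nu> ?Z) *s v (Suc k)
          = (of_nat (Suc k) * \<nu> ?Z) *s v (Suc k) + \<nu> ?Z *s v (Suc k)"
        by (subst vec.scale_left_distrib[symmetric]) (simp add: distrib_right)
      note c = this
      show ?thesis
        by (subst comm, subst c, simp only: vS matrix_vector_mult_diff_distrib matrix_vector_right_distrib
            vector_scalar_commute add_diff_eq diff_add_eq diff_diff_eq2 ac_simps)
           (simp only: diff_conv_add_uminus ac_simps)
    qed
    ultimately show ?case using vec.subspace_diff[OF sub] by metis
  qed
  obtain m where m: "v m \<in> S m" and min: "\<And>j. j < m \<Longrightarrow> v j \<notin> S j"
    using exists_krylov_relation[of v W] LeastI_ex[of "\<lambda>m. v m \<in> S m"] not_less_Least[of _ "\<lambda>m. v m \<in> S m"]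
    unfolding S_def by blast
  have "m \<noteq> 0" using m u by (metis S0 v0)
  then obtain k where k: "m = Suc k" by (metis not0_implies_Suc)
  have "(Y - mat (\<nu> Y)) *v v (Suc k) \<in> S k"
  proof (rule mapS[OF sub])
    fix x assume "x \<in> W"
    then have "Y *v x - \<nu> Y *s x \<in> W" using MW[OF Y] by (intro vec.subspace_diff vec.subspace_scale W)
    then show "(Y - mat (\<nu> Y)) *v x \<in> S k"
      using WS by (simp add: matrix_vector_mult_diff_rdistrib mat_vector_mult)
  next
    fix j assume "j < Suc k"
    then show "(Y - mat (\<nu> Y)) *v v j \<in> S k"
      using a[of j] Y mono[of j k] by (auto simp: matrix_vector_mult_diff_rdistrib mat_vector_mult)
  next
    show "v (Suc k) \<in> S (Suc k)" using m k by simp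
  qed
  then have "Y *v v (Suc k) - \<nu> Y *s v (Suc k) \<in> S k"
    by (simp add: matrix_vector_mult_diff_rdistrib mat_vector_mult)
  from vec.subspace_diff[OF sub b this]
  have "(of_nat (Suc k) * \<nu> (lie_bracket X Y)) *s v k \<in> S k" by simp
  then have "of_nat (Suc k) * \<nu> (lie_bracket X Y) = 0"
    using min[of k] k vec.subspace_scale[OF sub, of _ k "inverse (of_nat (Suc k) * \<nu> (lie_bracket X Y))"]
    by (metis lessI vector_smult_assoc left_inverse vector_smult_lid)
  then show ?thesis by (metis mult_eq_0_iff of_nat_neq_0)
qed


lemma lie_bracket_in_bracket_space:
  "X \<in> K \<Longrightarrow> Y \<in> L \<Longrightarrow> lie_bracket X Y \<in> bracket_space K L"
  unfolding bracket_space_def by (rule cmat.span_base) blast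

lemma bracket_space_subset:
  assumes "cmat.subspace T" "\<And>X Y. X \<in> K \<Longrightarrow> Y \<in> L \<Longrightarrow> lie_bracket X Y \<in> T"
  shows "bracket_space K L \<subseteq> T"
  unfolding bracket_space_def by (rule cmat.span_minimal) (use assms in auto)

lemma derived_series_Suc_inner:
  "derived_series L (Suc k) = derived_series (bracket_space L L) k"
  by (induction k) simp_all

text \<open>
  It is enough to find a common eigenvector for a spanning set of matrices.
\<close>
lemma subspace_eigen_mod:
  assumes "vec.subspace W"
  shows "cmat.subspace {Y. \<exists>\<mu>. Y *v v - \<mu> *s v \<in> W}"
proof (rule cmat.subspaceI)
  show "0 \<in> {Y. \<exists>\<mu>. Y *v v - \<mu> *s v \<in> W}"
    using assms by (auto intro!: exI[of _ 0] simp: vec.subspace_0)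
next
  fix X Y assume "X \<in> {Y. \<exists>\<mu>. Y *v v - \<mu> *s v \<in> W}" "Y \<in> {Y. \<exists>\<mu>. Y *v v - \<mu> *s v \<in> W}"
  then obtain a b where "X *v v - a *s v \<in> W" "Y *v v - b *s v \<in> W" by blast
  from vec.subspace_add[OF assms this]
  have "(X + Y) *v v - (a + b) *s v \<in> W"
    by (simp add: matrix_vector_mult_add_rdistrib vec.scale_left_distrib algebra_simps)
  then show "X + Y \<in> {Y. \<exists>\<mu>. Y *v v - \<mu> *s v \<in> W}" by blast
next
  fix c X assume "X \<in> {Y. \<exists>\<mu>. Y *v v - \<mu> *s v \<in> W}"
  then obtain a where "X *v v - a *s v \<in> W" by blast
  from vec.subspace_scale[OF assms this, of c]
  have "matrix_scale c X *v v - (c * a) *s v \<in> W"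
    by (simp add: vec.scale_right_diff_distrib vec_eq_iff matrix_scale_def
      matrix_vector_mult_def sum_distrib_left mult.assoc cong: if_cong)
       (simp add: matrix_scale_def matrix_vector_mult_def vector_scalar_mult_def sum_distrib_left
         algebra_simps minus_vec_def)
  then show "matrix_scale c X \<in> {Y. \<exists>\<mu>. Y *v v - \<mu> *s v \<in> W}" by blast
qed

text \<open>
  Stating Lie's theorem for a pair \<open>W \<subset> U\<close> instead of a representation on \<open>U / W\<close> keeps
  everything inside matrices acting on column vectors. The induction is on the derived length: a common
  eigenvector of \<open>D = [L, L]\<close> is improved to one of \<open>D \<union> F\<close> for finite sets \<open>F \<subseteq> L\<close>,
  one matrix at a time, and \<open>F\<close> is finally taken to be a basis of \<open>L\<close>. Adding any elements of
  \<open>L\<close> to \<open>D\<close> keeps the set stable under brackets with \<open>L\<close>, which is all that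
  \<open>weight_vanishes_on_bracket\<close> asks for.
\<close>
theorem lie_theorem_mod:
  fixes U W :: "(complex ^ 'm) set" and L :: "(complex ^ 'm ^ 'm) set"
  assumes U: "vec.subspace U" and W: "vec.subspace W" and WU: "W \<subset> U"
    and LU: "\<And>X x. X \<in> L \<Longrightarrow> x \<in> U \<Longrightarrow> X *v x \<in> U"
    and LW: "\<And>X x. X \<in> L \<Longrightarrow> x \<in> W \<Longrightarrow> X *v x \<in> W"
    and L: "lie_subalgebra L L"
    and solv: "lie_solvable L"
  shows "\<exists>v. v \<in> U \<and> v \<notin> W \<and> (\<forall>X\<in>L. \<exists>\<mu>. X *v v - \<mu> *s v \<in> W)"
proof -
  obtain k where "derived_series L k = {0}" using solv by (auto simp: lie_solvable_def)
  then show ?thesis using L LU LW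
  proof (induction k arbitrary: L)
    case 0
    obtain v where "v \<in> U" "v \<notin> W" using WU by blast
    with 0 vec.subspace_0[OF W] show ?case
      by (intro exI[of _ v]) (auto intro!: exI[of _ 0])
  next
    case (Suc k)
    define D where "D = bracket_space L L"
    have Lsub: "cmat.subspace L" and Lbr: "\<And>X Y. X \<in> L \<Longrightarrow> Y \<in> L \<Longrightarrow> lie_bracket X Y \<in> L"
      using Suc.prems(2) by (auto simp: lie_subalgebra_def)
    have DL: "D \<subseteq> L" unfolding D_def by (rule bracket_space_subset) (use Lsub Lbr in auto)
    have LLD: "lie_bracket X Y \<in> D" if "X \<in> L" "Y \<in> L" for X Y
      using that by (simp add: D_def lie_bracket_in_bracket_space)
    have "lie_subalgebra D D"
      unfolding lie_subalgebra_def using DL LLD by (auto simp: D_def bracket_space_def)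
    moreover have "derived_series D k = {0}"
      using Suc.prems(1) by (simp add: derived_series_Suc_inner D_def del: derived_series.simps)
    ultimately have base: "\<exists>v. v \<in> U \<and> v \<notin> W \<and> (\<forall>X\<in>D. \<exists>\<mu>. X *v v - \<mu> *s v \<in> W)"
      using DL Suc.prems(3,4) by (intro Suc.IH) auto
    have extend: "\<exists>v. v \<in> U \<and> v \<notin> W \<and> (\<forall>X\<in>D \<union> F. \<exists>\<mu>. X *v v - \<mu> *s v \<in> W)"
      if "finite F" "F \<subseteq> L" for F
      using that
    proof (induction F)
      case empty
      then show ?case using base by simp
    next
      case (insert X F)
      from insert.prems have "F \<subseteq> L" by simp
      from insert.IH[OF this] obtain u where u: "u \<in> U" "u \<notin> W"
        and eig: "\<forall>X\<in>D \<union> F. \<exists>\<mu>. X *v u - \<mu> *s u \<in> W"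
        by (elim exE conjE)
      obtain \<nu> where \<nu>: "\<And>Y. Y \<in> D \<union> F \<Longrightarrow> Y *v u - \<nu> Y *s u \<in> W"
        using bchoice[OF eig] by (elim exE) blast
      have XL: "X \<in> L" and FL: "D \<union> F \<subseteq> L" using insert.prems DL by auto
      have brM: "lie_bracket X Y \<in> D \<union> F" if "Y \<in> D \<union> F" for Y
        using LLD[OF XL, of Y] that FL by (metis UnI1 subsetD)
      have \<nu>0: "\<nu> (lie_bracket X Y) = 0" if "Y \<in> D \<union> F" for Y
      proof (rule weight_vanishes_on_bracket[OF W _ _ brM u(2) \<nu> that])
        show "X *v x \<in> W" if "x \<in> W" for x using that XL Suc.prems(4) by blast
        show "Y *v x \<in> W" if "Y \<in> D \<union> F" "x \<in> W" for Y x using that FL Suc.prems(4) by blast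
      qed
      define V where "V = {x \<in> U. \<forall>Y\<in>D \<union> F. Y *v x - \<nu> Y *s x \<in> W}"
      have VI: "x \<in> V" if "x \<in> U" "\<And>Y. Y \<in> D \<union> F \<Longrightarrow> Y *v x - \<nu> Y *s x \<in> W" for x
        using that unfolding V_def by blast
      have VU: "x \<in> U" and VW: "Y \<in> D \<union> F \<Longrightarrow> Y *v x - \<nu> Y *s x \<in> W" if "x \<in> V" for x Y
        using that unfolding V_def by blast+
      have Vsub: "vec.subspace V"
      proof (rule vec.subspaceI)
        show "0 \<in> V" by (rule VI) (simp_all add: vec.subspace_0 U W)
      next
        fix x y assume xy: "x \<in> V" "y \<in> V"
        show "x + y \<in> V"
        proof (rule VI)
          show "x + y \<in> U" by (intro vec.subspace_add U VU xy)
          fix Y assume "Y \<in> D \<union> F"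
          from vec.subspace_add[OF W VW[OF xy(1) this] VW[OF xy(2) this]]
          show "Y *v (x + y) - \<nu> Y *s (x + y) \<in> W"
            by (simp add: matrix_vector_right_distrib vec.scale_right_distrib algebra_simps)
        qed
      next
        fix c x assume x: "x \<in> V"
        show "c *s x \<in> V"
        proof (rule VI)
          show "c *s x \<in> U" by (intro vec.subspace_scale U VU x)
          fix Y assume "Y \<in> D \<union> F"
          from vec.subspace_scale[OF W VW[OF x this], of c]
          show "Y *v (c *s x) - \<nu> Y *s (c *s x) \<in> W"
            by (simp add: vector_scalar_commute vec.scale_right_diff_distrib mult.commute)
        qed
      qed
      \<comment> \<open>The simultaneous eigenspace is stable under the new matrix because the weight kills brackets with it.\<close>
      have XV: "X *v x \<in> V" if x: "x \<in> V" for x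
      proof (rule VI)
        show "X *v x \<in> U" by (rule Suc.prems(3)[OF XL VU[OF x]])
        fix Y assume Y: "Y \<in> D \<union> F"
        let ?Z = "lie_bracket X Y"
        have "X *v (Y *v x - \<nu> Y *s x) \<in> W"
          by (rule Suc.prems(4)[OF XL VW[OF x Y]])
        moreover have "?Z *v x - \<nu> ?Z *s x \<in> W" by (rule VW[OF x brM[OF Y]])
        moreover have "Y *v (X *v x) - \<nu> Y *s (X *v x) = X *v (Y *v x - \<nu> Y *s x) - (?Z *v x - \<nu> ?Z *s x)"
          unfolding \<nu>0[OF Y]
          by (simp add: lie_bracket_def matrix_vector_mul_assoc matrix_vector_mult_diff_rdistrib
              matrix_vector_mult_diff_distrib vector_scalar_commute)
        ultimately show "Y *v (X *v x) - \<nu> Y *s (X *v x) \<in> W"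
          using vec.subspace_diff[OF W] by presburger
      qed
      have "u \<in> V" using u(1) \<nu> by (rule VI)
      have "\<exists>v \<mu>. v \<in> V \<and> v \<notin> W \<and> X *v v - \<mu> *s v \<in> W"
        by (rule exists_eigenvector_mod[OF W Vsub _ \<open>u \<in> V\<close> u(2)]) (rule XV)
      then obtain v \<mu> where v: "v \<in> V" "v \<notin> W" "X *v v - \<mu> *s v \<in> W" by (elim exE conjE)
      show ?case
      proof (intro exI[of _ v] conjI ballI)
        fix Y assume "Y \<in> D \<union> insert X F"
        then consider "Y = X" | "Y \<in> D \<union> F" by blast
        then show "\<exists>\<mu>. Y *v v - \<mu> *s v \<in> W"
          by cases (use v(3) VW[OF v(1)] in blast)+
      qed (use v VU in auto)
    qed
    obtain F where F: "F \<subseteq> L" "cmat.independent F" "L \<subseteq> cmat.span F"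
      by (rule cmat.basis_exists)
    have "finite F" using F(2) by (rule cmat.finiteI_independent)
    from extend[OF this F(1)] obtain v where v: "v \<in> U" "v \<notin> W"
      and eig: "\<forall>X\<in>D \<union> F. \<exists>\<mu>. X *v v - \<mu> *s v \<in> W" by (elim exE conjE)
    have "F \<subseteq> {Y. \<exists>\<mu>. Y *v v - \<mu> *s v \<in> W}" using eig by (intro subsetI CollectI) (erule bspec, simp)
    from cmat.span_minimal[OF this subspace_eigen_mod[OF W]] F(3)
    have "L \<subseteq> {Y. \<exists>\<mu>. Y *v v - \<mu> *s v \<in> W}" by (rule order_trans[rotated])
    then have "\<forall>X\<in>L. \<exists>\<mu>. X *v v - \<mu> *s v \<in> W" by (intro ballI) (drule subsetD, assumption, simp)
    with v show ?case by (intro exI[of _ v] conjI)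
  qed
qed


section \<open>Isotropic flags and symplectic frames\<close>

abbreviation J :: "complex ^ ('n::finite + 'n) ^ ('n + 'n)" where
  "J \<equiv> symplectic_form"

lemma sum_UNIV_sum:
  fixes f :: "'a::finite + 'b::finite \<Rightarrow> 'c::comm_monoid_add"
  shows "(\<Sum>i\<in>UNIV. f i) = (\<Sum>a\<in>UNIV. f (Inl a)) + (\<Sum>b\<in>UNIV. f (Inr b))"
  unfolding UNIV_Plus_UNIV[symmetric] by (subst sum.Plus) auto

lemma symplectic_form_nth [simp]:
  "J $ Inl a $ Inl b = 0" "J $ Inr a $ Inr b = 0"
  "J $ Inl a $ Inr b = (if a = b then 1 else 0)" "J $ Inr a $ Inl b = (if a = b then -1 else 0)"
  by (simp_all add: symplectic_form_def)

lemma vec_eq_sum_iff: "x = y \<longleftrightarrow> (\<forall>a. x $ Inl a = y $ Inl a) \<and> (\<forall>b. x $ Inr b = y $ Inr b)"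
  for x y :: "'c ^ ('a::finite + 'b::finite)"
  unfolding vec_eq_iff by (metis sum.exhaust)

lemma sum_delta_mult:
  fixes f :: "'a::finite \<Rightarrow> complex"
  shows "(\<Sum>b\<in>UNIV. (if a = b then c else 0) * f b) = c * f a"
    and "(\<Sum>b\<in>UNIV. (if b = a then c else 0) * f b) = c * f a"
    and "(\<Sum>b\<in>UNIV. f b * (if a = b then c else 0)) = f a * c"
    and "(\<Sum>b\<in>UNIV. f b * (if b = a then c else 0)) = f a * c"
  by (simp_all add: if_distrib[of "\<lambda>x. x * _"] if_distrib[of "\<lambda>x. _ * x"] cong: if_cong)

lemma symplectic_form_square: "J ** J = - mat 1"
  by (simp add: vec_eq_sum_iff matrix_matrix_mult_def sum_UNIV_sum mat_def sum_delta_mult)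

lemma transpose_symplectic_form: "transpose J = - J"
  by (simp add: vec_eq_sum_iff transpose_def)

lemma matrix_add_rdistrib:
  fixes A B :: "complex ^ 'k ^ 'm" and C :: "complex ^ 'l ^ 'k"
  shows "(A + B) ** C = A ** C + B ** C"
  by (simp add: vec_eq_iff matrix_matrix_mult_def sum.distrib distrib_right)

lemma matrix_mul_minus:
  fixes A :: "complex ^ 'k ^ 'm" and B :: "complex ^ 'l ^ 'k"
  shows "(- A) ** B = - (A ** B)" "A ** (- B) = - (A ** B)"
  by (simp_all add: vec_eq_iff matrix_matrix_mult_def sum_negf)

lemma matrix_mul_scale:
  fixes A :: "complex ^ 'k ^ 'm" and B :: "complex ^ 'l ^ 'k"
  shows "matrix_scale c A ** B = matrix_scale c (A ** B)" "A ** matrix_scale c B = matrix_scale c (A ** B)"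
  by (simp_all add: vec_eq_iff matrix_matrix_mult_def matrix_scale_def sum_distrib_left algebra_simps)

lemma transpose_add: "transpose (A + B) = transpose A + transpose B"
  and transpose_minus: "transpose (- A) = - transpose A"
  and transpose_matrix_scale: "transpose (matrix_scale c A) = matrix_scale c (transpose A)"
  for A B :: "complex ^ 'k ^ 'm"
  by (simp_all add: vec_eq_iff transpose_def matrix_scale_def)

text \<open>
  The bilinear pairing, without complex conjugation.
\<close>
definition cdot :: "complex ^ 'm \<Rightarrow> complex ^ 'm \<Rightarrow> complex" where
  "cdot x y = (\<Sum>i\<in>UNIV. x $ i * y $ i)"

lemma cdot_commute: "cdot x y = cdot y x"
  by (simp add: cdot_def mult.commute)

lemma cdot_add_right: "cdot x (y + z) = cdot x y + cdot x z"
  and cdot_scale_right: "cdot x (c *s y) = c * cdot x y"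
  and cdot_minus_right: "cdot x (- y) = - cdot x y"
  by (simp_all add: cdot_def sum.distrib sum_distrib_left sum_negf algebra_simps)

lemma cdot_matrix_left: "cdot (A *v x) y = cdot x (transpose A *v y)"
proof -
  have "cdot (A *v x) y = (\<Sum>i\<in>UNIV. \<Sum>j\<in>UNIV. A $ i $ j * x $ j * y $ i)"
    by (simp add: cdot_def matrix_vector_mult_def sum_distrib_right)
  also have "\<dots> = (\<Sum>j\<in>UNIV. \<Sum>i\<in>UNIV. A $ i $ j * x $ j * y $ i)" by (rule sum.swap)
  also have "\<dots> = cdot x (transpose A *v y)"
    by (simp add: cdot_def matrix_vector_mult_def transpose_def sum_distrib_left algebra_simps
        del: transpose_matrix_vector)
  finally show ?thesis .
qed

lemma nth_transpose_mult:
  "(transpose A ** K ** B) $ i $ j = cdot (column i A) (K *v column j B)"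
  for A :: "complex ^ 'k ^ 'm"
  unfolding cdot_def matrix_matrix_mult_def matrix_vector_mult_def transpose_def column_def
  by (simp add: sum_distrib_left sum_distrib_right mult.assoc) (rule sum.swap)

definition omega :: "complex ^ ('n::finite + 'n) \<Rightarrow> complex ^ ('n + 'n) \<Rightarrow> complex" where
  "omega x y = cdot x (J *v y)"

lemma omega_swap: "omega x y = - omega y x"
  unfolding omega_def
  by (subst cdot_commute, subst cdot_matrix_left, simp only: transpose_symplectic_form)
     (simp add: cdot_def matrix_vector_mult_def sum_negf)

lemma omega_self [simp]: "omega x x = 0"
  using omega_swap[of x x] by simp

lemma omega_add_right: "omega x (y + z) = omega x y + omega x z"
  and omega_scale_right: "omega x (c *s y) = c * omega x y"
  by (simp_all add: omega_def matrix_vector_right_distrib vector_scalar_commute cdot_add_right cdot_scale_right)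

lemma subspace_omega_perp: "vec.subspace {x. omega y x = 0}"
proof (rule vec.subspaceI)
  show "0 \<in> {x. omega y x = 0}" by (simp add: omega_def cdot_def)
qed (simp_all add: omega_add_right omega_scale_right)

lemma omega_sp_algebra:
  assumes "X \<in> sp_algebra"
  shows "omega x (X *v y) = - omega (X *v x) y"
proof -
  have eq: "transpose X ** J = - (J ** X)"
    using assms by (simp add: sp_algebra_def eq_neg_iff_add_eq_0)
  have "omega (X *v x) y = cdot x ((transpose X ** J) *v y)"
    unfolding omega_def by (subst cdot_matrix_left) (simp add: matrix_vector_mul_assoc del: transpose_matrix_vector)
  also have "\<dots> = - omega x (X *v y)"
    unfolding eq omega_def
    by (simp add: matrix_vector_mul_assoc cdot_minus_right flip: cdot_minus_right)
       (simp add: cdot_def matrix_vector_mult_def sum_negf)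
  finally show ?thesis by simp
qed

text \<open>
  Each linear condition lowers the dimension by at most one.
\<close>
lemma dim_perp_ge:
  fixes v :: "nat \<Rightarrow> complex ^ ('n::finite + 'n)"
  shows "2 * CARD('n) \<le> vec.dim {x. \<forall>i<k. omega (v i) x = 0} + k"
proof (induction k)
  case 0
  then show ?case by (simp add: card_cart_basis)
next
  case (Suc k)
  let ?U = "{x. \<forall>i<k. omega (v i) x = 0}" and ?U' = "{x. \<forall>i<Suc k. omega (v i) x = 0}"
  have "vec.dim ?U \<le> vec.dim ?U' + 1"
  proof (cases "\<exists>u. u \<in> ?U \<and> omega (v k) u \<noteq> 0")
    case False
    then have "?U = ?U'" by (auto simp: less_Suc_eq)
    then show ?thesis by simp
  next
    case True
    then obtain u where u: "u \<in> ?U" "omega (v k) u \<noteq> 0" by blast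
    have "?U \<subseteq> vec.span (insert u ?U')"
    proof
      fix x assume x: "x \<in> ?U"
      define c where "c = omega (v k) x / omega (v k) u"
      have "x + (- c) *s u \<in> ?U'"
        using x u by (auto simp: less_Suc_eq omega_add_right omega_scale_right c_def
            simp del: vector_sneg_minus1 vec.scale_minus_left)
      then have "x + (- c) *s u \<in> vec.span (insert u ?U')" by (simp add: vec.span_base)
      moreover have "c *s u \<in> vec.span (insert u ?U')" by (simp add: vec.span_base vec.span_scale)
      ultimately have "(x + (- c) *s u) + c *s u \<in> vec.span (insert u ?U')" by (rule vec.span_add)
      then show "x \<in> vec.span (insert u ?U')" by simp
    qed
    then have "vec.dim ?U \<le> vec.dim (insert u ?U')" by (rule vec.dim_mono)
    also have "\<dots> \<le> vec.dim ?U' + 1" by (simp add: vec.dim_insert)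
    finally show ?thesis .
  qed
  with Suc show ?case by simp
qed

text \<open>
  Let \<open>W\<close> be the span of the vectors found so far. Since \<open>B\<close> lies in the symplectic algebra, the
  orthogonal space \<open>U\<close> of \<open>W\<close> is invariant as well, and \<open>dim U \<ge> 2 n - k > k \<ge> dim W\<close>
  as long as \<open>k < n\<close>. A common eigenvector in \<open>U\<close> modulo \<open>W\<close> is the next vector.
\<close>
lemma exists_isotropic_flag:
  fixes B :: "(complex ^ ('n::finite + 'n) ^ ('n + 'n)) set"
  assumes B: "lie_subalgebra B sp_algebra" "lie_solvable B" and "k \<le> CARD('n)"
  shows "\<exists>v :: nat \<Rightarrow> complex ^ ('n + 'n). \<forall>j<k. v j \<notin> vec.span (v ` {..<j}) \<and>
    (\<forall>i<k. omega (v i) (v j) = 0) \<and> (\<forall>X\<in>B. X *v v j \<in> vec.span (v ` {..j}))"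
  using \<open>k \<le> CARD('n)\<close>
proof (induction k)
  case (Suc k)
  then obtain v :: "nat \<Rightarrow> complex ^ ('n + 'n)" where
    v: "\<And>j. j < k \<Longrightarrow> v j \<notin> vec.span (v ` {..<j})"
       "\<And>i j. i < k \<Longrightarrow> j < k \<Longrightarrow> omega (v i) (v j) = 0"
       "\<And>j X. j < k \<Longrightarrow> X \<in> B \<Longrightarrow> X *v v j \<in> vec.span (v ` {..j})"
    by auto
  define W where "W = vec.span (v ` {..<k})"
  define U where "U = {x. \<forall>i<k. omega (v i) x = 0}"
  have Ws: "vec.subspace W" by (simp add: W_def)
  have "U = (\<Inter>i\<in>{..<k}. {x. omega (v i) x = 0})" by (auto simp: U_def)
  then have Us: "vec.subspace U" using subspace_omega_perp by (auto intro!: vec.subspace_Inter)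
  have WU: "W \<subseteq> U" unfolding W_def by (rule vec.span_minimal[OF _ Us]) (auto simp: U_def v(2))
  have "vec.dim W \<le> card (v ` {..<k})"
    unfolding W_def by (rule vec.dim_le_card) auto
  also have "\<dots> \<le> k" using card_image_le[of "{..<k}" v] by simp
  finally have "vec.dim W < vec.dim U"
    using dim_perp_ge[of k v] Suc.prems by (simp add: U_def)
  then have "W \<subset> U" using WU by auto
  have BW: "X *v x \<in> W" if "X \<in> B" "x \<in> W" for X x
  proof -
    have "vec.subspace {x. X *v x \<in> W}"
      using Ws by (auto intro!: vec.subspaceI simp: vec.subspace_0 vec.subspace_add
        vec.subspace_scale matrix_vector_right_distrib vector_scalar_commute)
    moreover have "v ` {..<k} \<subseteq> {x. X *v x \<in> W}"
    proof -
      have "X *v v j \<in> W" if "j < k" for j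
        using v(3)[OF that \<open>X \<in> B\<close>] vec.span_mono[of "v ` {..j}" "v ` {..<k}"] that
        unfolding W_def by fastforce
      then show ?thesis by auto
    qed
    ultimately show ?thesis using that(2) vec.span_minimal unfolding W_def by blast
  qed
  have UW: "omega y x = 0" if "x \<in> U" "y \<in> W" for x y
  proof -
    have "W \<subseteq> {y. omega x y = 0}"
      unfolding W_def using that(1) omega_swap[of x]
      by (intro vec.span_minimal subspace_omega_perp) (auto simp: U_def)
    then show ?thesis using that(2) omega_swap[of y x] by auto
  qed
  have BU: "X *v x \<in> U" if "X \<in> B" "x \<in> U" for X x
  proof -
    have "X \<in> sp_algebra" using that B by (auto simp: lie_subalgebra_def)
    moreover have "omega (X *v v i) x = 0" if "i < k" for i
      using that \<open>X \<in> B\<close> \<open>x \<in> U\<close> by (intro UW BW) (auto simp: W_def intro: vec.span_base)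
    ultimately show ?thesis by (simp add: U_def omega_sp_algebra)
  qed
  have "lie_subalgebra B B" using B by (simp add: lie_subalgebra_def)
  have "\<exists>w. w \<in> U \<and> w \<notin> W \<and> (\<forall>X\<in>B. \<exists>\<mu>. X *v w - \<mu> *s w \<in> W)"
    by (rule lie_theorem_mod[OF Us Ws \<open>W \<subset> U\<close> _ _ \<open>lie_subalgebra B B\<close> B(2)]) (fact BU, fact BW)
  then obtain w where w: "w \<in> U" "w \<notin> W" "\<And>X. X \<in> B \<Longrightarrow> \<exists>\<mu>. X *v w - \<mu> *s w \<in> W"
    by blast
  define v' where "v' = v(k := w)"
  have im: "v' ` {..<j} = v ` {..<j}" if "j \<le> k" for j using that by (auto simp: v'_def)
  have im': "v' ` {..j} = v ` {..j}" if "j < k" for j using that by (auto simp: v'_def)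
  have imk: "v' ` {..k} = insert w (v ` {..<k})"
    by (auto simp: v'_def simp flip: ivl_disj_un(2))
  have "v' j \<notin> vec.span (v' ` {..<j}) \<and> (\<forall>i<Suc k. omega (v' i) (v' j) = 0) \<and>
     (\<forall>X\<in>B. X *v v' j \<in> vec.span (v' ` {..j}))" if "j < Suc k" for j
  proof (cases "j = k")
    case True
    have "X *v w \<in> vec.span (insert w (v ` {..<k}))" if X: "X \<in> B" for X
    proof -
      obtain \<mu> where "X *v w - \<mu> *s w \<in> W" using w(3) X by blast
      then have "X *v w - \<mu> *s w \<in> vec.span (insert w (v ` {..<k}))"
        using vec.span_mono[of "v ` {..<k}" "insert w (v ` {..<k})"] by (auto simp: W_def)
      moreover have "\<mu> *s w \<in> vec.span (insert w (v ` {..<k}))"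
        by (simp add: vec.span_base vec.span_scale)
      ultimately show ?thesis using vec.span_add by fastforce
    qed
    moreover have "omega (v' i) w = 0" if "i < Suc k" for i
      using that w(1) by (auto simp: v'_def U_def less_Suc_eq)
    ultimately show ?thesis using True w(2) im[of k] imk by (simp add: W_def) (simp add: v'_def)
  next
    case False
    then have j: "j < k" using that by simp
    have "omega w (v j) = 0" using w(1) j omega_swap[of w "v j"] by (simp add: U_def)
    then show ?thesis using v j im[of j] im'[of j] by (auto simp: v'_def less_Suc_eq)
  qed
  then show ?case by blast
qed simp

definition symplectic :: "complex ^ ('n::finite + 'n) ^ ('n + 'n) \<Rightarrow> bool" where
  "symplectic g \<longleftrightarrow> transpose g ** J ** g = J"

text \<open>
  The columns of \<open>V\<close> are a basis of a Lagrangian subspace. A left inverse \<open>H\<close> of \<open>V\<close> gives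
  vectors \<open>W0 = - J H\<^sup>T\<close> dual to them, and adding to \<open>W0\<close> combinations of the columns of \<open>V\<close>
  makes the dual vectors isotropic as well.
\<close>
lemma exists_symplectic_extension:
  fixes V :: "complex ^ 'n ^ ('n::finite + 'n)" and H :: "complex ^ ('n + 'n) ^ 'n"
  assumes iso: "transpose V ** J ** V = 0" and H: "H ** V = mat 1"
  shows "\<exists>g. symplectic g \<and> (\<forall>a. column (Inl a) g = column a V)"
proof -
  define W0 where "W0 = - (J ** transpose H)"
  define M where "M = transpose W0 ** J ** W0"
  \<comment> \<open>Replacing \<open>W0\<close> by \<open>W0 + V C\<close> changes the Gram matrix \<open>M\<close> into \<open>M - C + C\<^sup>T\<close>, and \<open>M\<close> is skew-symmetric.\<close>
  define C where "C = matrix_scale (1/2) M"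
  define W where "W = W0 + V ** C"
  have "transpose V ** J ** W0 = - (transpose V ** (J ** J) ** transpose H)"
    by (simp add: W0_def matrix_mul_minus matrix_mul_assoc)
  also have "\<dots> = transpose V ** transpose H"
    by (simp add: symplectic_form_square matrix_mul_minus)
  also have "\<dots> = mat 1" by (simp add: H flip: matrix_transpose_mul)
  finally have VW0: "transpose V ** J ** W0 = mat 1" .
  have tr: "transpose (transpose P ** J ** Q) = - (transpose Q ** J ** P)"
    for P Q :: "complex ^ 'n ^ ('n + 'n)"
    by (simp add: matrix_transpose_mul transpose_symplectic_form matrix_mul_minus matrix_mul_assoc)
  have W0V: "transpose W0 ** J ** V = - mat 1"
    using tr[of V W0] VW0 by (simp add: minus_equation_iff)
  have MT: "transpose M = - M" using tr[of W0 W0] by (simp add: M_def)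
  then have CT: "transpose C = - C" by (simp add: C_def transpose_matrix_scale)
  have VW: "transpose V ** J ** W = mat 1"
    using VW0 iso by (simp add: W_def matrix_add_ldistrib matrix_mul_assoc)
  have WV: "transpose W ** J ** V = - mat 1"
    using tr[of V W] VW by (simp add: minus_equation_iff)
  have "transpose W ** J ** W = transpose W ** J ** W0 + transpose W ** J ** V ** C"
    by (simp add: W_def[of] matrix_add_ldistrib matrix_mul_assoc)
  also have "transpose W ** J ** W0 = M + transpose C ** (transpose V ** J ** W0)"
    by (simp add: W_def transpose_add matrix_transpose_mul matrix_add_rdistrib matrix_mul_assoc M_def)
  finally have "transpose W ** J ** W = M - C - C"
    by (simp add: VW0 WV CT matrix_mul_minus)
  also have "\<dots> = 0" by (simp add: C_def vec_eq_iff matrix_scale_def)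
  finally have WW: "transpose W ** J ** W = 0" .
  define g :: "complex ^ ('n + 'n) ^ ('n + 'n)" where
    "g = (\<chi> i j. case j of Inl a \<Rightarrow> V $ i $ a | Inr a \<Rightarrow> W $ i $ a)"
  have colg: "column (Inl a) g = column a V" "column (Inr a) g = column a W" for a
    by (simp_all add: g_def column_def vec_eq_iff)
  have "symplectic g"
    unfolding symplectic_def vec_eq_sum_iff[of "transpose g ** J ** g"] vec_eq_sum_iff[of "_ $ _"]
    unfolding nth_transpose_mult colg
    unfolding nth_transpose_mult[symmetric] iso VW WV WW
    by (simp add: mat_def)
  then show ?thesis using colg by blast
qed


section \<open>Conjugation by symplectic matrices\<close>

lemma transpose_zero [simp]: "transpose (0 :: complex ^ 'k ^ 'm) = 0"
  by (simp add: transpose_def vec_eq_iff)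

lemma transpose_diff: "transpose (A - B) = transpose A - transpose B"
  for A B :: "complex ^ 'k ^ 'm"
  by (simp add: vec_eq_iff transpose_def)

lemma matrix_mul_diff:
  fixes A :: "complex ^ 'k ^ 'm" and B :: "complex ^ 'l ^ 'k"
  shows "(A - A') ** B = A ** B - A' ** B" "A ** (B - B') = A ** B - A ** B'"
  by (simp_all add: vec_eq_iff matrix_matrix_mult_def sum_subtractf algebra_simps)

lemma matrix_mul_zero [simp]:
  fixes A :: "complex ^ 'k ^ 'm"
  shows "A ** 0 = (0 :: complex ^ 'l ^ 'm)"
  by (simp_all add: vec_eq_iff matrix_matrix_mult_def)

lemma mult_axis: "A *v axis k 1 = column k (A :: complex ^ 'k ^ 'm)"
  by (simp add: vec_eq_iff matrix_vector_mult_def axis_def column_def if_distrib cong: if_cong)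

text \<open>
  The inverse of a symplectic matrix, as a polynomial expression that makes sense for every matrix.
\<close>
definition sinv :: "complex ^ ('n::finite + 'n) ^ ('n + 'n) \<Rightarrow> complex ^ ('n + 'n) ^ ('n + 'n)" where
  "sinv g = - (J ** transpose g ** J)"

lemma sinv_sinv [simp]: "sinv (sinv g) = g"
proof -
  have "sinv (sinv g) = (J ** J) ** g ** (J ** J)"
    by (simp add: sinv_def matrix_transpose_mul transpose_symplectic_form transpose_minus
        matrix_mul_minus matrix_mul_assoc)
  then show ?thesis by (simp add: symplectic_form_square matrix_mul_minus)
qed

lemma sinv_transpose: "transpose (sinv g) ** J = J ** g"
proof -
  have "transpose (sinv g) ** J = - (J ** g ** (J ** J))"
    by (simp add: sinv_def matrix_transpose_mul transpose_symplectic_form transpose_minus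
        matrix_mul_minus matrix_mul_assoc)
  then show ?thesis by (simp add: symplectic_form_square matrix_mul_minus)
qed

lemma sinv_mult:
  assumes "symplectic g"
  shows "sinv g ** g = mat 1" "g ** sinv g = mat 1"
proof -
  have "sinv g ** g = - (J ** (transpose g ** J ** g))"
    by (simp add: sinv_def matrix_mul_minus matrix_mul_assoc)
  then show "sinv g ** g = mat 1"
    using assms by (simp add: symplectic_def symplectic_form_square)
  then show "g ** sinv g = mat 1" by (simp add: matrix_left_right_inverse)
qed

definition conjugate :: "complex ^ ('n::finite + 'n) ^ ('n + 'n) \<Rightarrow> complex ^ ('n + 'n) ^ ('n + 'n)
    \<Rightarrow> complex ^ ('n + 'n) ^ ('n + 'n)" where
  "conjugate g X = g ** X ** sinv g"

lemma conjugate_linear: "Vector_Spaces.linear matrix_scale matrix_scale (conjugate g)"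
  by (unfold_locales)
     (simp_all add: conjugate_def matrix_add_ldistrib matrix_add_rdistrib matrix_mul_scale)

lemma conjugate_sinv:
  assumes "symplectic g"
  shows "conjugate (sinv g) (conjugate g X) = X" "conjugate g (conjugate (sinv g) X) = X"
proof -
  have "conjugate (sinv g) (conjugate g X) = (sinv g ** g) ** X ** (sinv g ** g)"
    by (simp add: conjugate_def matrix_mul_assoc)
  then show "conjugate (sinv g) (conjugate g X) = X" using sinv_mult[OF assms] by simp
  have "conjugate g (conjugate (sinv g) X) = (g ** sinv g) ** X ** (g ** sinv g)"
    by (simp add: conjugate_def matrix_mul_assoc)
  then show "conjugate g (conjugate (sinv g) X) = X" using sinv_mult[OF assms] by simp
qed

lemma conjugate_bracket:
  assumes "symplectic g"
  shows "conjugate g (lie_bracket X Y) = lie_bracket (conjugate g X) (conjugate g Y)"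
proof -
  have "conjugate g A ** conjugate g B = conjugate g (A ** B)" for A B
  proof -
    have "conjugate g A ** conjugate g B = g ** A ** (sinv g ** g) ** B ** sinv g"
      by (simp add: conjugate_def matrix_mul_assoc)
    then show ?thesis using sinv_mult[OF assms] by (simp add: conjugate_def matrix_mul_assoc)
  qed
  then show ?thesis by (simp add: lie_bracket_def) (simp add: conjugate_def matrix_mul_diff)
qed

text \<open>
  True for every \<open>g\<close>, invertible or not, as \<open>sinv g\<close> is the adjoint of \<open>g\<close> with respect to the
  symplectic form.
\<close>
lemma conjugate_sp_algebra:
  assumes "X \<in> sp_algebra"
  shows "conjugate g X \<in> sp_algebra"
proof -
  have "J ** g = transpose (sinv g) ** J" by (rule sinv_transpose[symmetric])
  moreover have "transpose g ** J = J ** sinv g"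
  proof -
    have "J ** sinv g = - ((J ** J) ** transpose g ** J)"
      by (simp add: sinv_def matrix_mul_minus matrix_mul_assoc)
    then show ?thesis by (simp add: symplectic_form_square matrix_mul_minus)
  qed
  ultimately have "transpose (conjugate g X) ** J + J ** conjugate g X
      = transpose (sinv g) ** (transpose X ** J + J ** X) ** sinv g"
    by (simp add: conjugate_def matrix_transpose_mul matrix_add_ldistrib matrix_add_rdistrib matrix_mul_assoc)
       (simp add: matrix_mul_assoc[symmetric])
  then show ?thesis using assms by (simp add: sp_algebra_def)
qed

interpretation cmat_pair: finite_dimensional_vector_space_pair
  "matrix_scale :: complex \<Rightarrow> complex ^ 'k::finite ^ 'm::finite \<Rightarrow> complex ^ 'k ^ 'm"
  "cmat.extend_basis {}"
  "matrix_scale :: complex \<Rightarrow> complex ^ 'k::finite ^ 'm::finite \<Rightarrow> complex ^ 'k ^ 'm"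
  "cmat.extend_basis {}" ..

lemma conjugate_span: "cmat.span (conjugate g ` S) = conjugate g ` cmat.span S"
  by (rule cmat_pair.linear_span_image[OF conjugate_linear])

lemma conjugate_subspace: "cmat.subspace S \<Longrightarrow> cmat.subspace (conjugate g ` S)"
  by (rule cmat_pair.linear_subspace_image[OF conjugate_linear])

lemma conjugate_inj: "symplectic g \<Longrightarrow> inj (conjugate g)"
  by (metis conjugate_sinv(1) injI)

lemma conjugate_dim: "symplectic g \<Longrightarrow> cmat.dim (conjugate g ` S) = cmat.dim S"
  by (rule cmat_pair.dim_image_eq[OF conjugate_linear]) (rule inj_on_subset[OF conjugate_inj subset_UNIV])

lemma conjugate_bracket_space:
  assumes "symplectic g"
  shows "bracket_space (conjugate g ` K) (conjugate g ` L) = conjugate g ` bracket_space K L"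
proof -
  have "{lie_bracket X Y | X Y. X \<in> conjugate g ` K \<and> Y \<in> conjugate g ` L}
      = conjugate g ` {lie_bracket X Y | X Y. X \<in> K \<and> Y \<in> L}"
  proof (intro equalityI subsetI)
    fix Z assume "Z \<in> {lie_bracket X Y | X Y. X \<in> conjugate g ` K \<and> Y \<in> conjugate g ` L}"
    then obtain X Y where "X \<in> K" "Y \<in> L" "Z = lie_bracket (conjugate g X) (conjugate g Y)" by blast
    then show "Z \<in> conjugate g ` {lie_bracket X Y | X Y. X \<in> K \<and> Y \<in> L}"
      by (auto simp flip: conjugate_bracket[OF assms])
  next
    fix Z assume "Z \<in> conjugate g ` {lie_bracket X Y | X Y. X \<in> K \<and> Y \<in> L}"
    then show "Z \<in> {lie_bracket X Y | X Y. X \<in> conjugate g ` K \<and> Y \<in> conjugate g ` L}"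
      using conjugate_bracket[OF assms] by blast
  qed
  then show ?thesis by (simp add: bracket_space_def conjugate_span)
qed

lemma conjugate_derived_series:
  "symplectic g \<Longrightarrow> derived_series (conjugate g ` L) k = conjugate g ` derived_series L k"
  by (induction k) (simp_all add: conjugate_bracket_space)

lemma conjugate_zero [simp]: "conjugate g 0 = 0"
  by (simp add: conjugate_def)

lemma conjugate_lie_solvable: "symplectic g \<Longrightarrow> lie_solvable L \<Longrightarrow> lie_solvable (conjugate g ` L)"
  unfolding lie_solvable_def by (metis conjugate_derived_series conjugate_zero image_empty image_insert)

lemma conjugate_lie_subalgebra:
  assumes "symplectic g" "lie_subalgebra L sp_algebra"
  shows "lie_subalgebra (conjugate g ` L) sp_algebra"
  using assms unfolding lie_subalgebra_def
  by (auto simp: conjugate_bracket[symmetric] intro!: conjugate_subspace conjugate_sp_algebra)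

lemma conjugate_abelian_ideal:
  assumes g: "symplectic g" and I: "abelian_ideal I L"
  shows "abelian_ideal (conjugate g ` I) (conjugate g ` L)"
proof -
  have "cmat.subspace I" "I \<subseteq> L" "\<And>X Y. X \<in> L \<Longrightarrow> Y \<in> I \<Longrightarrow> lie_bracket X Y \<in> I"
    "\<And>X Y. X \<in> I \<Longrightarrow> Y \<in> I \<Longrightarrow> lie_bracket X Y = 0"
    using I by (auto simp: abelian_ideal_def lie_ideal_def)
  then show ?thesis
    unfolding abelian_ideal_def lie_ideal_def
    by (auto simp: conjugate_bracket[OF g, symmetric] intro!: conjugate_subspace)
qed

lemma conjugate_image_sinv:
  assumes "symplectic g"
  shows "conjugate (sinv g) ` conjugate g ` S = S" "conjugate g ` conjugate (sinv g) ` S = S"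
  by (simp_all add: image_image conjugate_sinv[OF assms])

lemma symplectic_sinv:
  assumes "symplectic g"
  shows "symplectic (sinv g)"
proof -
  have "transpose (sinv g) ** J = J ** g" by (rule sinv_transpose)
  then show ?thesis
    unfolding symplectic_def using sinv_mult(2)[OF assms] by (simp flip: matrix_mul_assoc)
qed

lemma conjugate_abelian_ideals_eq:
  assumes g: "symplectic g"
  shows "{I. abelian_ideal I (conjugate g ` L) \<and> cmat.dim I = d}
    = (`) (conjugate g) ` {I. abelian_ideal I L \<and> cmat.dim I = d}"
proof (intro equalityI subsetI)
  fix I assume "I \<in> {I. abelian_ideal I (conjugate g ` L) \<and> cmat.dim I = d}"
  then have "abelian_ideal (conjugate (sinv g) ` I) L" "cmat.dim (conjugate (sinv g) ` I) = d"
    using conjugate_abelian_ideal[OF symplectic_sinv[OF g], of I "conjugate g ` L"]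
    by (auto simp: conjugate_image_sinv[OF g] conjugate_dim symplectic_sinv[OF g])
  moreover have "I = conjugate g ` conjugate (sinv g) ` I" by (simp add: conjugate_image_sinv[OF g])
  ultimately show "I \<in> (`) (conjugate g) ` {I. abelian_ideal I L \<and> cmat.dim I = d}" by blast
qed (auto simp: conjugate_abelian_ideal[OF g] conjugate_dim[OF g])

section \<open>Every Borel subalgebra is conjugate to the standard one\<close>

text \<open>
  Let \<open>F k\<close> consist of the matrices that lower the position \<open>p\<close> of basis vectors by at least \<open>k\<close>. The bracket
  adds up these degrees, and the diagonal of a bracket of two triangular matrices is zero; hence the derived
  series descends at least one step at a time.
\<close>
lemma lie_solvable_upper_triangular:
  fixes L :: "(complex ^ 'm ^ 'm) set" and p :: "'m \<Rightarrow> nat"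
  assumes p: "inj p" and L: "\<And>X i j. X \<in> L \<Longrightarrow> p j < p i \<Longrightarrow> X $ i $ j = 0"
  shows "lie_solvable L"
proof -
  define F where "F k = {X :: complex ^ 'm ^ 'm. \<forall>i j. p j < p i + k \<longrightarrow> X $ i $ j = 0}" for k
  have Fsub: "cmat.subspace (F k)" for k
    by (rule cmat.subspaceI) (auto simp: F_def matrix_scale_def)
  have mult: "X ** Y \<in> F (k + l)" if X: "X \<in> F k" and Y: "Y \<in> F l" for X Y k l
  proof -
    have "X $ i $ c * Y $ c $ j = 0" if "p j < p i + (k + l)" for i j c
    proof (cases "p c < p i + k")
      case False
      then have "p j < p c + l" using that by simp
      then show ?thesis using Y by (simp add: F_def)
    qed (use X in \<open>simp add: F_def\<close>)
    then show ?thesis unfolding F_def matrix_matrix_mult_def by (auto intro!: sum.neutral)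
  qed
  have step: "bracket_space K K \<subseteq> F (Suc (Suc k))" if "K \<subseteq> F (Suc k)" for K k
  proof (rule bracket_space_subset[OF Fsub])
    fix X Y assume "X \<in> K" "Y \<in> K"
    then have "lie_bracket X Y \<in> F (Suc k + Suc k)"
      unfolding lie_bracket_def using that by (intro cmat.subspace_diff Fsub mult) auto
    then show "lie_bracket X Y \<in> F (Suc (Suc k))" by (simp add: F_def)
  qed
  have start: "bracket_space L L \<subseteq> F 1"
  proof (rule bracket_space_subset[OF Fsub])
    fix X Y assume XY: "X \<in> L" "Y \<in> L"
    have F0: "X \<in> F 0" "Y \<in> F 0" using XY L by (auto simp: F_def)
    have diag: "(A ** B) $ i $ i = A $ i $ i * B $ i $ i" if "A \<in> F 0" "B \<in> F 0" for A B i
    proof -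
      have "A $ i $ c * B $ c $ i = (if c = i then A $ i $ i * B $ i $ i else 0)" for c
        using that p by (cases "p c" "p i" rule: linorder_cases) (auto simp: F_def inj_eq)
      then have "(\<Sum>c\<in>UNIV. A $ i $ c * B $ c $ i)
          = (\<Sum>c\<in>UNIV. if c = i then A $ i $ i * B $ i $ i else 0)"
        by (rule sum.cong[OF refl])
      then show ?thesis by (simp add: matrix_matrix_mult_def)
    qed
    have "lie_bracket X Y \<in> F 0"
      unfolding lie_bracket_def using mult[OF F0] mult[OF F0(2,1)]
      by (intro cmat.subspace_diff Fsub) auto
    moreover have "lie_bracket X Y $ i $ i = 0" for i
      by (simp add: lie_bracket_def diag F0)
    ultimately show "lie_bracket X Y \<in> F 1"
      using p by (auto simp: F_def less_Suc_eq inj_eq)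
  qed
  have ds: "derived_series L (Suc k) \<subseteq> F (Suc k)" for k
  proof (induction k)
    case (Suc k)
    show ?case unfolding derived_series.simps(2)[of L "Suc k"] by (rule step[OF Suc])
  qed (use start in simp)
  define N where "N = (\<Sum>i\<in>UNIV. p i)"
  have pN: "p i \<le> N" for i unfolding N_def by (rule member_le_sum) auto
  have "p j < p i + Suc N" for i j using pN[of j] by simp
  then have "F (Suc N) \<subseteq> {0}" unfolding F_def vec_eq_iff by (auto simp: vec_eq_iff)
  moreover have "0 \<in> derived_series L (Suc N)" by (simp add: bracket_space_def cmat.span_zero)
  ultimately have "derived_series L (Suc N) = {0}" using ds[of N] by (intro equalityI) auto
  then show ?thesis unfolding lie_solvable_def by blast
qed

lemma sp_algebra_iff:
  "X \<in> sp_algebra \<longleftrightarrow> (\<forall>a b. X $ Inr a $ Inr b = - X $ Inl b $ Inl a \<and>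
     X $ Inl a $ Inr b = X $ Inl b $ Inr a \<and> X $ Inr a $ Inl b = X $ Inr b $ Inl a)"
  unfolding sp_algebra_def mem_Collect_eq
    vec_eq_sum_iff[of "transpose X ** J + J ** X"] vec_eq_sum_iff[of "_ $ _"]
  by (simp add: matrix_matrix_mult_def transpose_def sum_UNIV_sum sum_delta_mult)
     (auto simp: add_eq_0_iff)

lemma sp_algebra_subspace: "cmat.subspace sp_algebra"
  by (rule cmat.subspaceI) (auto simp: sp_algebra_iff matrix_scale_def)

lemma sp_algebra_bracket:
  fixes X Y :: "complex ^ ('n::finite + 'n) ^ ('n + 'n)"
  assumes "X \<in> sp_algebra" "Y \<in> sp_algebra"
  shows "lie_bracket X Y \<in> sp_algebra"
proof -
  have tr: "transpose X ** J = - (J ** X)" "transpose Y ** J = - (J ** Y)"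
    using assms by (simp_all add: sp_algebra_def eq_neg_iff_add_eq_0)
  have "transpose (X ** Y) ** J = J ** Y ** X" if "transpose X ** J = - (J ** X)" "transpose Y ** J = - (J ** Y)"
    for X Y :: "complex ^ ('n + 'n) ^ ('n + 'n)"
  proof -
    have "transpose (X ** Y) ** J = transpose Y ** (transpose X ** J)"
      by (simp add: matrix_transpose_mul matrix_mul_assoc)
    also have "\<dots> = - ((transpose Y ** J) ** X)"
      unfolding that(1) by (simp add: matrix_mul_minus matrix_mul_assoc)
    also have "\<dots> = J ** Y ** X" unfolding that(2) by (simp add: matrix_mul_minus)
    finally show ?thesis .
  qed
  from this[OF tr] this[OF tr(2,1)] show ?thesis
    by (simp add: sp_algebra_def lie_bracket_def transpose_diff matrix_mul_diff matrix_mul_assoc)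
qed

text \<open>
  The index type carries no order of its own; \<open>r\<close> enumerates it in the order of the flag.
\<close>
locale index_order =
  fixes r :: "'n::finite \<Rightarrow> nat"
  assumes bij: "bij_betw r UNIV {..<CARD('n)}"
begin

lemma r_less [simp]: "r a < CARD('n)"
  using bij by (auto simp: bij_betw_def)

lemma r_eq_iff [simp]: "r a = r b \<longleftrightarrow> a = b"
  using bij by (auto simp: bij_betw_def inj_eq)

lemma r_surj: "k < CARD('n) \<Longrightarrow> \<exists>a. r a = k"
  using bij by (auto simp: bij_betw_def) (metis imageE lessThan_iff)

text \<open>
  The order of the symplectic basis in which the standard Borel subalgebra is upper triangular: the dual
  vectors follow the Lagrangian ones, in the reverse order.
\<close>
definition pos :: "'n + 'n \<Rightarrow> nat" where
  "pos i = (case i of Inl a \<Rightarrow> r a | Inr a \<Rightarrow> 2 * CARD('n) - r a)"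

lemma pos_simps [simp]: "pos (Inl a) = r a" "pos (Inr a) = 2 * CARD('n) - r a"
  by (simp_all add: pos_def)

lemma pos_less [simp]:
  "pos (Inl a) < pos (Inr b)" "pos (Inr a) < pos (Inr b) \<longleftrightarrow> r b < r a"
  unfolding pos_simps using r_less[of a] r_less[of b] by (linarith, arith)

lemma inj_pos: "inj pos"
proof (rule injI)
  fix i j assume eq: "pos i = pos j"
  show "i = j"
  proof (cases i; cases j)
    fix a b assume "i = Inr a" "j = Inr b"
    then show ?thesis using eq pos_less(2)[of a b] pos_less(2)[of b a]
      by (metis less_irrefl linorder_neqE_nat r_eq_iff)
  qed (use eq pos_less(1) in \<open>metis less_irrefl pos_simps(1) r_eq_iff\<close>)+
qed

definition std_borel :: "(complex ^ ('n + 'n) ^ ('n + 'n)) set" where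
  "std_borel = {X \<in> sp_algebra. \<forall>i j. pos j < pos i \<longrightarrow> X $ i $ j = 0}"

lemma std_borel_iff:
  "X \<in> std_borel \<longleftrightarrow> X \<in> sp_algebra \<and> (\<forall>a b. X $ Inr a $ Inl b = 0) \<and>
    (\<forall>a b. r b < r a \<longrightarrow> X $ Inl a $ Inl b = 0)"
proof (intro iffI conjI allI impI)
  assume X: "X \<in> std_borel"
  then show "X \<in> sp_algebra" "X $ Inr a $ Inl b = 0" for a b
    using pos_less(1) unfolding std_borel_def by blast+
  show "X $ Inl a $ Inl b = 0" if "r b < r a" for a b
    using X that pos_simps(1) unfolding std_borel_def by force
next
  assume X: "X \<in> sp_algebra \<and> (\<forall>a b. X $ Inr a $ Inl b = 0) \<and>
    (\<forall>a b. r b < r a \<longrightarrow> X $ Inl a $ Inl b = 0)"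
  have "X $ i $ j = 0" if "pos j < pos i" for i j
  proof (cases i; cases j)
    fix a b assume ij: "i = Inl a" "j = Inr b"
    then show ?thesis using that pos_less(1)[of a b] by simp
  next
    fix a b assume ij: "i = Inr a" "j = Inr b"
    then have "r a < r b" using that pos_less(2) by metis
    then show ?thesis using X ij by (simp add: sp_algebra_iff)
  qed (use X that in auto)
  then show "X \<in> std_borel" using X by (simp add: std_borel_def)
qed

lemma std_borel_subalgebra: "lie_subalgebra std_borel sp_algebra"
  unfolding lie_subalgebra_def
proof (intro conjI ballI)
  show "std_borel \<subseteq> sp_algebra" by (auto simp: std_borel_def)
  show "cmat.subspace std_borel"
  proof -
    have "cmat.subspace {X :: complex ^ ('n + 'n) ^ ('n + 'n). \<forall>i j. pos j < pos i \<longrightarrow> X $ i $ j = 0}"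
      by (rule cmat.subspaceI) (auto simp: matrix_scale_def)
    moreover have "std_borel = sp_algebra \<inter> {X. \<forall>i j. pos j < pos i \<longrightarrow> X $ i $ j = 0}"
      by (auto simp: std_borel_def)
    ultimately show ?thesis using cmat.subspace_inter[OF sp_algebra_subspace] by simp
  qed
  fix X Y assume XY: "X \<in> std_borel" "Y \<in> std_borel"
  have mult: "(X ** Y) $ i $ j = 0" if "X \<in> std_borel" "Y \<in> std_borel" "pos j < pos i" for X Y i j
  proof -
    have "X $ i $ c * Y $ c $ j = 0" for c
    proof (cases "pos c < pos i")
      case False
      then have "pos j < pos c" using that by simp
      then show ?thesis using that by (simp add: std_borel_def)
    qed (use that in \<open>simp add: std_borel_def\<close>)
    then show ?thesis unfolding matrix_matrix_mult_def by (auto intro!: sum.neutral)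
  qed
  have "lie_bracket X Y \<in> sp_algebra" using XY by (auto simp: std_borel_def intro: sp_algebra_bracket)
  then show "lie_bracket X Y \<in> std_borel"
    using mult[OF XY] mult[OF XY(2,1)] by (simp add: std_borel_def[of] lie_bracket_def)
qed

lemma std_borel_solvable: "lie_solvable std_borel"
  by (rule lie_solvable_upper_triangular[OF inj_pos]) (simp add: std_borel_def)

text \<open>
  A symplectic frame adapted to an invariant isotropic flag conjugates \<open>B\<close> into the standard Borel
  subalgebra; since that one is solvable too, maximality of \<open>B\<close> turns the inclusion into an equality.
\<close>
theorem borel_conjugate:
  assumes B: "borel_subalgebra B sp_algebra"
  shows "\<exists>g. symplectic g \<and> B = conjugate g ` std_borel"
proof -
  have sub: "lie_subalgebra B sp_algebra" and solv: "lie_solvable B"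
    and max: "\<And>C. lie_subalgebra C sp_algebra \<Longrightarrow> lie_solvable C \<Longrightarrow> B \<subseteq> C \<Longrightarrow> C = B"
    using B by (auto simp: borel_subalgebra_def)
  obtain v :: "nat \<Rightarrow> complex ^ ('n + 'n)" where
    indep: "\<And>j. j < CARD('n) \<Longrightarrow> v j \<notin> vec.span (v ` {..<j})" and
    iso: "\<And>i j. i < CARD('n) \<Longrightarrow> j < CARD('n) \<Longrightarrow> omega (v i) (v j) = 0" and
    inv: "\<And>j X. j < CARD('n) \<Longrightarrow> X \<in> B \<Longrightarrow> X *v v j \<in> vec.span (v ` {..j})"
    using exists_isotropic_flag[OF sub solv order_refl] by blast
  define V :: "complex ^ 'n ^ ('n + 'n)" where "V = (\<chi> i a. v (r a) $ i)"
  have colV: "column a V = v (r a)" for a by (simp add: V_def column_def vec_eq_iff)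
  have "transpose V ** J ** V = 0"
    by (simp add: vec_eq_iff[where 'b = 'n] nth_transpose_mult colV iso flip: omega_def)
  moreover have "\<exists>H. H ** V = mat 1"
    unfolding matrix_left_invertible_independent_columns
  proof (rule ccontr, clarsimp)
    fix c a assume sum0: "(\<Sum>i\<in>UNIV. c i *s column i V) = 0" and a: "c a \<noteq> 0"
    \<comment> \<open>In a nontrivial relation the last vector with a nonzero coefficient would depend on the earlier ones.\<close>
    define k where "k = Max (r ` {a. c a \<noteq> 0})"
    have "k \<in> r ` {a. c a \<noteq> 0}" unfolding k_def using a by (intro Max_in) auto
    then obtain b where b: "c b \<noteq> 0" "k = r b" by auto
    have le: "r e \<le> k" if "c e \<noteq> 0" for e unfolding k_def using that by (intro Max_ge) auto
    have "c b *s v k + (\<Sum>i\<in>UNIV - {b}. c i *s v (r i)) = 0"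
      using sum0 by (simp add: colV b(2) sum.remove[of UNIV b])
    then have eq: "c b *s v k = - (\<Sum>i\<in>UNIV - {b}. c i *s v (r i))"
      by (simp add: eq_neg_iff_add_eq_0)
    have "c i *s v (r i) \<in> vec.span (v ` {..<k})" if "i \<noteq> b" for i
    proof (cases "c i = 0")
      case False
      then have "r i < k" using le[OF False] that b(2) by (metis le_neq_implies_less r_eq_iff)
      then show ?thesis by (intro vec.span_scale vec.span_base) auto
    qed (simp add: vec.span_zero)
    then have "c b *s v k \<in> vec.span (v ` {..<k})"
      unfolding eq by (intro vec.span_neg vec.span_sum) auto
    from vec.span_scale[OF this, of "inverse (c b)"] have "v k \<in> vec.span (v ` {..<k})"
      using b(1) by simp
    then show False using indep[of k] b(2) by simp
  qed
  ultimately obtain g where g: "symplectic g" "\<And>a. column (Inl a) g = v (r a)"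
    using exists_symplectic_extension unfolding colV[symmetric] by metis
  have hv: "sinv g *v v (r a) = axis (Inl a) 1" for a
  proof -
    have "v (r a) = g *v axis (Inl a) 1" by (simp only: mult_axis g(2))
    then show ?thesis by (simp add: matrix_vector_mul_assoc sinv_mult[OF g(1)])
  qed
  have conjB: "conjugate (sinv g) X \<in> std_borel" if X: "X \<in> B" for X
  proof -
    have sp: "conjugate (sinv g) X \<in> sp_algebra"
      using X sub by (intro conjugate_sp_algebra) (auto simp: lie_subalgebra_def)
    have entry: "conjugate (sinv g) X $ i $ Inl a = (sinv g *v (X *v v (r a))) $ i" for i a
    proof -
      have "sinv g *v (X *v v (r a)) = conjugate (sinv g) X *v axis (Inl a) 1"
        by (simp add: conjugate_def g(2)[symmetric] mult_axis[symmetric] matrix_vector_mul_assoc matrix_mul_assoc)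
      then show ?thesis by (simp add: mult_axis column_def)
    qed
    have zero: "conjugate (sinv g) X $ i $ Inl a = 0" if "\<And>b. r b \<le> r a \<Longrightarrow> i \<noteq> Inl b" for i a
    proof -
      have "vec.subspace {x. (sinv g *v x) $ i = 0}"
        by (rule vec.subspaceI) (simp_all add: matrix_vector_right_distrib vector_scalar_commute)
      moreover have "v ` {..r a} \<subseteq> {x. (sinv g *v x) $ i = 0}"
      proof
        fix x assume "x \<in> v ` {..r a}"
        then obtain k where k: "k \<le> r a" "x = v k" by auto
        then obtain b where "r b = k" using r_surj[of k] r_less[of a] by auto
        then show "x \<in> {x. (sinv g *v x) $ i = 0}"
          using k that[of b] hv[of b] by (auto simp: axis_def)
      qed
      ultimately have "vec.span (v ` {..r a}) \<subseteq> {x. (sinv g *v x) $ i = 0}"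
        by (intro vec.span_minimal)
      then show ?thesis using inv[of "r a" X] X entry by auto
    qed
    show ?thesis
      unfolding std_borel_iff by (intro conjI allI impI sp zero) auto
  qed
  have "conjugate g ` std_borel = B"
  proof (rule max)
    show "B \<subseteq> conjugate g ` std_borel"
    proof
      fix X assume "X \<in> B"
      then show "X \<in> conjugate g ` std_borel"
        using conjB[of X] conjugate_sinv(2)[OF g(1), of X] by (metis imageI)
    qed
  qed (use g(1) in \<open>auto intro: conjugate_lie_subalgebra conjugate_lie_solvable std_borel_subalgebra std_borel_solvable\<close>)
  then show ?thesis using g(1) by blast
qed

end


section \<open>Counting symmetric down-sets\<close>

definition sym_downsets :: "nat \<Rightarrow> (nat \<times> nat) set set" where
  "sym_downsets n = {P. P \<subseteq> {..<n} \<times> {..<n} \<and> sym P \<and>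
     (\<forall>i j k. (i, j) \<in> P \<longrightarrow> k \<le> i \<longrightarrow> (k, j) \<in> P)}"

text \<open>
  The cells on or above the diagonal; they will index a basis of the ideal.
\<close>
definition weight :: "(nat \<times> nat) set \<Rightarrow> nat" where
  "weight P = card {(i, j) \<in> P. i \<le> j}"

text \<open>
  Shift \<open>P\<close> by one cell in both directions and fill the first row and the first column.
\<close>
definition add_hook :: "nat \<Rightarrow> (nat \<times> nat) set \<Rightarrow> (nat \<times> nat) set" where
  "add_hook n P = {(i, j). i \<le> n \<and> j \<le> n \<and> (i = 0 \<or> j = 0 \<or> (i - 1, j - 1) \<in> P)}"

lemma finite_sym_downsets: "finite (sym_downsets n)"
  by (rule finite_subset[of _ "Pow ({..<n} \<times> {..<n})"]) (auto simp: sym_downsets_def)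

lemma sym_downsetsD:
  assumes "P \<in> sym_downsets n"
  shows "(i, j) \<in> P \<Longrightarrow> i < n \<and> j < n" "(i, j) \<in> P \<Longrightarrow> (j, i) \<in> P"
    "(i, j) \<in> P \<Longrightarrow> k \<le> i \<Longrightarrow> (k, j) \<in> P"
  using assms by (auto simp: sym_downsets_def dest: symD)

lemma add_hook_sym_downset:
  assumes "P \<in> sym_downsets n"
  shows "add_hook n P \<in> sym_downsets (Suc n)"
proof -
  note P = sym_downsetsD[OF assms]
  have "sym (add_hook n P)" by (auto simp: add_hook_def sym_def dest: P(2))
  moreover have "(k, j) \<in> add_hook n P" if "(i, j) \<in> add_hook n P" "k \<le> i" for i j k
    using that P(3)[of "i - 1" "j - 1" "k - 1"] diff_le_mono[of k i 1] by (auto simp: add_hook_def)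
  ultimately show ?thesis by (auto simp: sym_downsets_def) (auto simp: add_hook_def)
qed

text \<open>
  The two kinds of down-sets are told apart by the last cell \<open>(0, n)\<close> of the first row.
\<close>
lemma sym_downsets_Suc:
  "sym_downsets (Suc n) = sym_downsets n \<union> add_hook n ` sym_downsets n"
proof (intro equalityI subsetI)
  fix Q assume Q: "Q \<in> sym_downsets (Suc n)"
  note D = sym_downsetsD[OF Q]
  show "Q \<in> sym_downsets n \<union> add_hook n ` sym_downsets n"
  proof (cases "(0, n) \<in> Q")
    case False
    then have "j \<noteq> n" if "(i, j) \<in> Q" for i j using D(3)[OF that, of 0] by auto
    then have "i < n \<and> j < n" if "(i, j) \<in> Q" for i j
      using D(1)[OF that] D(2)[OF that] that by (metis less_Suc_eq)
    then have "Q \<in> sym_downsets n" using Q by (auto simp: sym_downsets_def)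
    then show ?thesis by blast
  next
    case True
    define P where "P = {(i, j). (Suc i, Suc j) \<in> Q}"
    have "P \<in> sym_downsets n"
      using D(1) by (auto simp: sym_downsets_def P_def sym_def intro: D(2) D(3))
    moreover have "Q = add_hook n P"
    proof -
      have col: "(i, 0) \<in> Q" if "i \<le> n" for i using D(3)[OF D(2)[OF True] that] .
      then have row: "(0, i) \<in> Q" if "i \<le> n" for i using D(2) that by blast
      have "(i, j) \<in> Q \<longleftrightarrow> (i, j) \<in> add_hook n P" for i j
        using col[of i] row[of j] D(1)[of i j]
        by (cases i; cases j) (auto simp: add_hook_def P_def)
      then show ?thesis by auto
    qed
    ultimately show ?thesis by blast
  qed
next
  fix Q assume "Q \<in> sym_downsets n \<union> add_hook n ` sym_downsets n"
  then show "Q \<in> sym_downsets (Suc n)"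
  proof
    assume "Q \<in> sym_downsets n"
    then show ?thesis by (fastforce simp: sym_downsets_def)
  qed (auto intro: add_hook_sym_downset)
qed

lemma inj_on_add_hook: "inj_on (add_hook n) (sym_downsets n)"
proof (rule inj_onI)
  fix P Q assume P: "P \<in> sym_downsets n" and Q: "Q \<in> sym_downsets n" and eq: "add_hook n P = add_hook n Q"
  have "R = {(i, j). (Suc i, Suc j) \<in> add_hook n R}" if "R \<in> sym_downsets n" for R
    using sym_downsetsD(1)[OF that] by (auto simp: add_hook_def Suc_le_eq)
  from this[OF P] this[OF Q] eq show "P = Q" by simp
qed

lemma weight_add_hook:
  assumes "P \<in> sym_downsets n"
  shows "weight (add_hook n P) = Suc n + weight P"
proof -
  note P = sym_downsetsD[OF assms]
  have fin: "finite P" using assms by (auto simp: sym_downsets_def intro: finite_subset)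
  have "{(i, j) \<in> add_hook n P. i \<le> j} = Pair 0 ` {..n} \<union> map_prod Suc Suc ` {(i, j) \<in> P. i \<le> j}"
    (is "?A = ?B \<union> ?C")
  proof -
    have "(i, j) \<in> ?A \<longleftrightarrow> (i, j) \<in> ?B \<union> ?C" for i j
      using P(1)[of "i - 1" "j - 1"] by (cases i; cases j) (auto simp: add_hook_def image_iff)
    then show ?thesis by auto
  qed
  moreover have "card (?B \<union> ?C) = card ?B + card ?C"
    by (rule card_Un_disjoint) (auto intro: finite_subset[OF _ fin])
  moreover have "card ?B = Suc n" by (simp add: card_image inj_on_def)
  moreover have "card ?C = weight P"
    unfolding weight_def by (rule card_image) (auto simp: inj_on_def)
  ultimately show ?thesis by (simp add: weight_def)
qed

lemma sum_weight_sym_downsets: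
  "(\<Sum>P\<in>sym_downsets n. monom 1 (weight P)) = (\<Prod>j = 1..n. 1 + monom (1 :: nat) j)"
proof (induction n)
  case 0
  have "sym_downsets 0 = {{}}" by (auto simp: sym_downsets_def sym_def)
  then show ?case by (simp add: weight_def monom_0 one_pCons)
next
  case (Suc n)
  let ?m = "\<lambda>P. monom (1 :: nat) (weight P)"
  have disj: "sym_downsets n \<inter> add_hook n ` sym_downsets n = {}"
  proof -
    have "(0, n) \<in> add_hook n P" for P by (simp add: add_hook_def)
    then show ?thesis using sym_downsetsD(1) by blast
  qed
  have "(\<Sum>P\<in>sym_downsets (Suc n). ?m P)
      = (\<Sum>P\<in>sym_downsets n. ?m P) + (\<Sum>P\<in>sym_downsets n. ?m (add_hook n P))"
    unfolding sym_downsets_Suc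
    by (simp add: sum.union_disjoint finite_sym_downsets disj sum.reindex[OF inj_on_add_hook])
  also have "(\<Sum>P\<in>sym_downsets n. ?m (add_hook n P)) = monom 1 (Suc n) * (\<Sum>P\<in>sym_downsets n. ?m P)"
    unfolding sum_distrib_left
    by (rule sum.cong[OF refl]) (simp add: weight_add_hook mult_monom)
  finally show ?case by (simp add: Suc algebra_simps del: One_nat_def)
qed

lemma card_sym_downsets_of_weight:
  "card {P \<in> sym_downsets n. weight P = d} = coeff (\<Prod>j = 1..n. 1 + monom (1 :: nat) j) d"
proof -
  have "coeff (\<Prod>j = 1..n. 1 + monom (1 :: nat) j) d = (\<Sum>P\<in>sym_downsets n. if weight P = d then 1 else 0)"
    unfolding sum_weight_sym_downsets[symmetric] by (simp only: coeff_sum coeff_monom)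
  also have "\<dots> = card {P \<in> sym_downsets n. weight P = d}"
    by (simp only: card_eq_sum sum.inter_filter[OF finite_sym_downsets])
  finally show ?thesis by simp
qed

section \<open>Abelian ideals of the standard Borel subalgebra\<close>

text \<open>
  The form of the elements of the parabolic subalgebra that stabilises the Lagrangian subspace of the first
  \<open>n\<close> coordinates, when \<open>S\<close> is symmetric.
\<close>
definition blk :: "complex ^ 'n ^ 'n \<Rightarrow> complex ^ 'n ^ 'n \<Rightarrow> complex ^ ('n::finite + 'n) ^ ('n + 'n)" where
  "blk A S = (\<chi> i j. case (i, j) of
      (Inl a, Inl b) \<Rightarrow> A $ a $ b
    | (Inl a, Inr b) \<Rightarrow> S $ a $ b
    | (Inr a, Inr b) \<Rightarrow> - A $ b $ a
    | (Inr a, Inl b) \<Rightarrow> 0)"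

lemma blk_nth [simp]:
  "blk A S $ Inl a $ Inl b = A $ a $ b" "blk A S $ Inl a $ Inr b = S $ a $ b"
  "blk A S $ Inr a $ Inr b = - A $ b $ a" "blk A S $ Inr a $ Inl b = 0"
  by (simp_all add: blk_def)

lemma mat_eq_sum_iff: "X = Y \<longleftrightarrow> (\<forall>a b. X $ Inl a $ Inl b = Y $ Inl a $ Inl b \<and>
    X $ Inl a $ Inr b = Y $ Inl a $ Inr b \<and> X $ Inr a $ Inl b = Y $ Inr a $ Inl b \<and>
    X $ Inr a $ Inr b = Y $ Inr a $ Inr b)"
  for X Y :: "complex ^ ('n::finite + 'n) ^ ('n + 'n)"
  unfolding vec_eq_sum_iff[of X] vec_eq_sum_iff[of "_ $ _"] by blast

lemma blk_eq_iff [simp]: "blk A S = blk A' S' \<longleftrightarrow> A = A' \<and> S = S'"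
  by (auto simp: mat_eq_sum_iff vec_eq_iff)

lemma blk_zero [simp]: "blk 0 0 = 0"
  and blk_add: "blk A S + blk A' S' = blk (A + A') (S + S')"
  and blk_scale: "matrix_scale c (blk A S) = blk (matrix_scale c A) (matrix_scale c S)"
  by (simp_all add: mat_eq_sum_iff matrix_scale_def)

text \<open>
  The adjoint action of the diagonal block on the abelian nilradical, which is made of symmetric matrices.
\<close>
definition act :: "complex ^ 'n ^ 'n \<Rightarrow> complex ^ 'n ^ 'n \<Rightarrow> complex ^ 'n ^ 'n" where
  "act A S = A ** S + S ** transpose A"

lemma act_nth: "act A S $ a $ b = (\<Sum>c\<in>UNIV. A $ a $ c * S $ c $ b + S $ a $ c * A $ b $ c)"
  by (simp add: act_def matrix_matrix_mult_def transpose_def sum.distrib)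

lemma lie_bracket_blk:
  "lie_bracket (blk A S) (blk A' S') = blk (lie_bracket A A') (act A S' - act A' S)"
  by (simp add: mat_eq_sum_iff lie_bracket_def act_nth matrix_matrix_mult_def sum_UNIV_sum
      sum_negf sum.distrib sum_subtractf algebra_simps)

lemma transpose_act: "transpose S = S \<Longrightarrow> transpose (act A S) = act A S"
  by (simp add: act_def transpose_add matrix_transpose_mul add.commute)

lemma act_matrix_unit_nth:
  "act (matrix_unit c a) S $ k $ l = (if k = c then S $ a $ l else 0) + (if l = c then S $ k $ a else 0)"
  by (cases "k = c"; cases "l = c") (simp_all add: act_nth matrix_unit_def sum.distrib sum_delta_mult)

lemma act_matrix_unit_diag:
  "act (matrix_unit a a) S $ k $ l = ((if k = a then 1 else 0) + (if l = a then 1 else 0)) * S $ k $ l"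
  by (simp add: act_matrix_unit_nth)

text \<open>
  The root vector of weight \<open>\<epsilon>\<^sub>a + \<epsilon>\<^sub>b\<close>; for \<open>a = b\<close> it is twice a matrix unit.
\<close>
definition sym_unit :: "'n \<Rightarrow> 'n \<Rightarrow> complex ^ 'n ^ 'n" where
  "sym_unit a b = matrix_unit a b + matrix_unit b a"

lemma sym_unit_nth: "sym_unit a b $ k $ l =
    (if k = a \<and> l = b then 1 else 0) + (if k = b \<and> l = a then 1 else 0)"
  by (simp add: sym_unit_def matrix_unit_def)

lemma sym_unit_nth_eq_0_iff: "sym_unit a b $ k $ l = 0 \<longleftrightarrow> \<not> (k = a \<and> l = b) \<and> \<not> (k = b \<and> l = a)"
proof -
  have "(if P then 1 else 0) + (if Q then 1 else 0) = (0 :: complex) \<longleftrightarrow> \<not> P \<and> \<not> Q" for P Q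
    by (cases P; cases Q) simp_all
  then show ?thesis by (simp only: sym_unit_nth)
qed

lemma sym_unit_commute: "sym_unit a b = sym_unit b a"
  by (simp add: sym_unit_def add.commute)

lemma transpose_sym_unit [simp]: "transpose (sym_unit a b) = sym_unit a b"
proof -
  have "transpose (matrix_unit a b) = matrix_unit b a" for a b :: 'a
    by (simp add: vec_eq_iff transpose_def matrix_unit_def conj_commute)
  then show ?thesis by (simp add: sym_unit_def transpose_add add.commute)
qed

lemma symmetric_nth: "transpose S = S \<Longrightarrow> S $ a $ b = S $ b $ a"
proof -
  assume "transpose S = S"
  then have "transpose S $ a $ b = S $ a $ b" by simp
  then show ?thesis by (simp add: transpose_def)
qed

text \<open>
  The diagonal matrix unit at \<open>a\<close> multiplies the entry at \<open>(k, l)\<close> by the number of indices among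
  \<open>k, l\<close> that are equal to \<open>a\<close>. The polynomials \<open>x y\<close> and \<open>x\<^sup>2 - x\<close> in these operators therefore
  pick out single weight spaces: \<open>x\<^sup>2 - x\<close> vanishes at \<open>0\<close> and \<open>1\<close> and equals \<open>2\<close> at \<open>2\<close>.
\<close>
lemma torus_projection:
  assumes "transpose S = S"
  shows "a \<noteq> b \<Longrightarrow> act (matrix_unit a a) (act (matrix_unit b b) S) = matrix_scale (S $ a $ b) (sym_unit a b)"
    and "act (matrix_unit a a) (act (matrix_unit a a) S) - act (matrix_unit a a) S
      = matrix_scale (S $ a $ a) (sym_unit a a)"
proof -
  have sym: "S $ b $ a = S $ a $ b" by (rule symmetric_nth[OF assms])
  show "act (matrix_unit a a) (act (matrix_unit b b) S) = matrix_scale (S $ a $ b) (sym_unit a b)"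
    if "a \<noteq> b"
    unfolding vec_eq_iff
  proof (intro allI)
    fix k l
    have "act (matrix_unit a a) (act (matrix_unit b b) S) $ k $ l
        = (if k = a \<and> l = b \<or> k = b \<and> l = a then S $ k $ l else 0)"
      using that by (auto simp only: act_matrix_unit_diag mult_zero_left mult_zero_right mult_1_left
          add_0_left add_0_right split: if_split)
    also have "\<dots> = matrix_scale (S $ a $ b) (sym_unit a b) $ k $ l"
      using that by (auto simp: matrix_scale_def sym_unit_nth sym)
    finally show "act (matrix_unit a a) (act (matrix_unit b b) S) $ k $ l
        = matrix_scale (S $ a $ b) (sym_unit a b) $ k $ l" .
  qed
  show "act (matrix_unit a a) (act (matrix_unit a a) S) - act (matrix_unit a a) S
      = matrix_scale (S $ a $ a) (sym_unit a a)"
    unfolding vec_eq_iff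
  proof (intro allI)
    fix k l
    show "(act (matrix_unit a a) (act (matrix_unit a a) S) - act (matrix_unit a a) S) $ k $ l
        = matrix_scale (S $ a $ a) (sym_unit a a) $ k $ l"
      by (cases "k = a"; cases "l = a")
         (simp_all add: act_matrix_unit_diag matrix_scale_def sym_unit_nth)
  qed
qed

text \<open>
  Every off-diagonal cell occurs twice in the sum, and the diagonal root vectors are twice matrix units; this
  is the factor \<open>1/2\<close>.
\<close>
lemma symmetric_expansion:
  assumes "transpose S = S"
  shows "S = (\<Sum>p\<in>UNIV. matrix_scale (S $ fst p $ snd p / 2) (sym_unit (fst p) (snd p)))"
proof -
  have "(\<Sum>p\<in>UNIV. matrix_scale (S $ fst p $ snd p / 2) (sym_unit (fst p) (snd p))) $ a $ b = S $ a $ b" for a b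
  proof -
    have sym: "S $ b $ a = S $ a $ b" by (rule symmetric_nth[OF assms])
    have "matrix_scale (S $ fst p $ snd p / 2) (sym_unit (fst p) (snd p)) $ a $ b =
        S $ fst p $ snd p / 2 * (if p = (a, b) then 1 else 0) +
        S $ fst p $ snd p / 2 * (if p = (b, a) then 1 else 0)" for p
    proof -
      have "a = fst p \<and> b = snd p \<longleftrightarrow> p = (a, b)" "a = snd p \<and> b = fst p \<longleftrightarrow> p = (b, a)"
        by (auto simp: prod_eq_iff)
      then show ?thesis
        by (simp only: matrix_scale_def sym_unit_nth vec_lambda_beta distrib_left)
    qed
    then show ?thesis
      unfolding sum_component by (simp only: sum.distrib sum_delta_mult sym fst_conv snd_conv) simp
  qed
  then show ?thesis by (simp add: vec_eq_iff)
qed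

context index_order
begin

definition upper :: "complex ^ 'n ^ 'n \<Rightarrow> bool" where
  "upper A \<longleftrightarrow> (\<forall>a b. r b < r a \<longrightarrow> A $ a $ b = 0)"

lemma blk_in_std_borel_iff: "blk A S \<in> std_borel \<longleftrightarrow> upper A \<and> transpose S = S"
  unfolding std_borel_iff sp_algebra_iff
  by (auto simp: upper_def vec_eq_iff transpose_def)

lemma std_borelE:
  assumes "X \<in> std_borel"
  obtains A S where "X = blk A S" "upper A" "transpose S = S"
proof -
  define A where "A = (\<chi> a b. X $ Inl a $ Inl b)"
  define S where "S = (\<chi> a b. X $ Inl a $ Inr b)"
  have "X = blk A S" using assms by (simp add: mat_eq_sum_iff A_def S_def std_borel_iff sp_algebra_iff)
  with assms that show thesis by (metis blk_in_std_borel_iff)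
qed

lemma upper_matrix_unit: "r a \<le> r b \<Longrightarrow> upper (matrix_unit a b)"
  by (auto simp: upper_def matrix_unit_def)

definition radical_ideal :: "(nat \<times> nat) set \<Rightarrow> (complex ^ ('n + 'n) ^ ('n + 'n)) set" where
  "radical_ideal P = {blk 0 S | S. transpose S = S \<and> (\<forall>a b. S $ a $ b \<noteq> 0 \<longrightarrow> (r a, r b) \<in> P)}"

text \<open>
  Bracketing an element of the ideal with the symmetric matrix unit at \<open>j\<close> gives an element of the ideal with
  zero diagonal block, and bracketing once more must give zero: \<open>A\<close> acts with square zero on these matrix
  units. The diagonal entries of the result are \<open>2 A\<^sub>k\<^sub>j\<^sup>2\<close> for \<open>k \<noteq> j\<close>, so that \<open>A\<close> is
  diagonal, and then \<open>4 A\<^sub>j\<^sub>j\<^sup>2\<close>.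
\<close>
lemma abelian_ideal_diagonal_block:
  assumes I: "abelian_ideal I std_borel" and X: "blk A S \<in> I"
  shows "A = 0"
proof -
  have br: "\<And>X Y. X \<in> std_borel \<Longrightarrow> Y \<in> I \<Longrightarrow> lie_bracket X Y \<in> I"
    and ab: "\<And>X Y. X \<in> I \<Longrightarrow> Y \<in> I \<Longrightarrow> lie_bracket X Y = 0"
    using I by (auto simp: abelian_ideal_def lie_ideal_def)
  have sq: "act A (act A (matrix_unit j j)) = 0" for j
  proof -
    let ?T = "- act A (matrix_unit j j)"
    have "blk 0 (matrix_unit j j) \<in> std_borel"
      by (auto simp: blk_in_std_borel_iff upper_def transpose_def matrix_unit_def vec_eq_iff)
    from br[OF this X] have "blk 0 ?T \<in> I"
      by (simp add: lie_bracket_blk) (simp add: lie_bracket_def act_def)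
    from ab[OF X this] have "blk (lie_bracket A 0) (act A ?T - act 0 S) = blk 0 0"
      by (simp add: lie_bracket_blk)
    then have "act A ?T - act 0 S = 0" by (simp only: blk_eq_iff)
    moreover have "act A (- S) = - act A S" for S by (simp add: act_def matrix_mul_minus)
    moreover have "act 0 S = 0" by (simp add: act_def)
    ultimately show ?thesis by simp
  qed
  have diag: "act A (act A (matrix_unit j j)) $ k $ k
      = (if k = j then 2 * (\<Sum>c\<in>UNIV. A $ j $ c * A $ c $ j) else 0) + 2 * (A $ k $ j)\<^sup>2" for j k
  proof -
    have entry: "act A (matrix_unit j j) $ k $ l
        = (if l = j then A $ k $ j else 0) + (if k = j then A $ l $ j else 0)" for k l
      by (cases "l = j"; cases "k = j") (simp_all add: act_nth matrix_unit_def sum.distrib sum_delta_mult flip: sum_distrib_left)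
    show ?thesis
      unfolding act_nth[of A "act A _"] entry
      by (cases "k = j") (simp_all add: sum.distrib sum_delta_mult distrib_left distrib_right
          power2_eq_square mult.commute flip: sum_distrib_left)
  qed
  have off: "A $ k $ j = 0" if "k \<noteq> j" for k j
    using diag[of j k] that by (simp add: sq)
  have "A $ j $ j = 0" for j
  proof -
    have "(\<Sum>c\<in>UNIV. A $ j $ c * A $ c $ j) = (\<Sum>c\<in>UNIV. if c = j then (A $ j $ j)\<^sup>2 else 0)"
      by (rule sum.cong[OF refl]) (auto simp: off power2_eq_square)
    then show ?thesis using diag[of j j] by (simp add: sq)
  qed
  then have "A $ k $ j = 0" for k j using off by metis
  then show ?thesis by (simp add: vec_eq_iff)
qed

text \<open>
  The torus projections show that an ideal contains the root vector of every cell at which some element is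
  nonzero, so it is spanned by the root vectors of a set of cells. The elementary matrix at \<open>(c, a)\<close>, upper
  triangular when \<open>c\<close> precedes \<open>a\<close>, carries the cell \<open>(a, b)\<close> to \<open>(c, b)\<close>: the set is
  a down-set.
\<close>
lemma abelian_ideal_imp_radical_ideal:
  assumes I: "abelian_ideal I std_borel"
  shows "\<exists>P\<in>sym_downsets CARD('n). I = radical_ideal P"
proof -
  have Isub: "cmat.subspace I" and IL: "I \<subseteq> std_borel"
    and br: "\<And>X Y. X \<in> std_borel \<Longrightarrow> Y \<in> I \<Longrightarrow> lie_bracket X Y \<in> I"
    using I by (auto simp: abelian_ideal_def lie_ideal_def)
  define N where "N = {S. blk 0 S \<in> I}"
  have IN: "\<exists>S\<in>N. X = blk 0 S" if XI: "X \<in> I" for X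
  proof -
    obtain A S where X: "X = blk A S" using XI IL by (blast elim: std_borelE)
    with XI have "A = 0" using abelian_ideal_diagonal_block[OF I] by blast
    with X XI show ?thesis by (auto simp: N_def)
  qed
  have Nsym: "transpose S = S" if "S \<in> N" for S
    using that IL blk_in_std_borel_iff by (auto simp: N_def)
  have Nsub: "cmat.subspace N"
  proof (rule cmat.subspaceI)
    show "0 \<in> N" using Isub by (simp add: N_def cmat.subspace_0)
    show "S + T \<in> N" if "S \<in> N" "T \<in> N" for S T
      using cmat.subspace_add[OF Isub, of "blk 0 S" "blk 0 T"] that by (simp add: N_def blk_add)
    show "matrix_scale c S \<in> N" if "S \<in> N" for c S
      using cmat.subspace_scale[OF Isub, of "blk 0 S" c] that by (simp add: N_def blk_scale)
  qed
  have Nact: "act A S \<in> N" if "upper A" "S \<in> N" for A S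
  proof -
    have "lie_bracket (blk A 0) (blk 0 S) \<in> I"
      using that by (intro br) (auto simp: blk_in_std_borel_iff N_def)
    then show ?thesis by (simp add: lie_bracket_blk N_def) (simp add: lie_bracket_def act_def)
  qed
  have unit: "sym_unit a b \<in> N" if S: "S \<in> N" "S $ a $ b \<noteq> 0" for S a b
  proof -
    note tp = torus_projection(1)[OF Nsym[OF S(1)], of a b] torus_projection(2)[OF Nsym[OF S(1)], of a]
    have "matrix_scale (S $ a $ b) (sym_unit a b) \<in> N"
    proof (cases "a = b")
      case True
      have "act (matrix_unit a a) (act (matrix_unit a a) S) - act (matrix_unit a a) S \<in> N"
        using S(1) by (intro cmat.subspace_diff Nsub Nact upper_matrix_unit) auto
      then show ?thesis using tp(2) True by simp
    next
      case False
      have "act (matrix_unit a a) (act (matrix_unit b b) S) \<in> N"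
        using S(1) by (intro Nact upper_matrix_unit) auto
      then show ?thesis using tp(1)[OF False] by simp
    qed
    from cmat.subspace_scale[OF Nsub this, of "inverse (S $ a $ b)"] show ?thesis
      using S(2) by simp
  qed
  define P where "P = {(r a, r b) | a b. sym_unit a b \<in> N}"
  have P_iff: "(r a, r b) \<in> P \<longleftrightarrow> sym_unit a b \<in> N" for a b
    by (auto simp: P_def)
  have "P \<in> sym_downsets CARD('n)"
  proof -
    have "sym P" by (auto simp: sym_def P_def) (metis sym_unit_commute)
    moreover have "P \<subseteq> {..<CARD('n)} \<times> {..<CARD('n)}" by (auto simp: P_def)
    moreover have "(k, j) \<in> P" if ij: "(i, j) \<in> P" and k: "k \<le> i" for i j k
    proof (cases "k = i")
      case False
      from ij obtain a b where ab: "i = r a" "j = r b" "sym_unit a b \<in> N" by (auto simp: P_def)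
      then obtain c where c: "k = r c" using r_surj[of k] k r_less[of a] by auto
      then have "c \<noteq> a" using False ab by auto
      have inN: "act (matrix_unit c a) (sym_unit a b) \<in> N"
        using ab k c by (intro Nact upper_matrix_unit) auto
      have "act (matrix_unit c a) (sym_unit a b) $ c $ b
          = sym_unit a b $ a $ b + (if b = c then sym_unit a b $ c $ a else 0)"
        by (simp add: act_matrix_unit_nth)
      moreover have "sym_unit a b $ a $ b = (if a = b then 2 else 1)" by (simp add: sym_unit_nth)
      moreover have "sym_unit a c $ c $ a = 1" using \<open>c \<noteq> a\<close> by (simp add: sym_unit_nth)
      ultimately have "act (matrix_unit c a) (sym_unit a b) $ c $ b \<noteq> 0"
        using \<open>c \<noteq> a\<close> by (cases "a = b"; cases "b = c") simp_all
      with inN have "sym_unit c b \<in> N" by (rule unit)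
      then show ?thesis using ab c P_iff by simp
    qed (use ij in simp)
    ultimately show ?thesis by (auto simp: sym_downsets_def)
  qed
  moreover have "I = radical_ideal P"
  proof (intro equalityI subsetI)
    fix X assume "X \<in> I"
    then obtain S where "S \<in> N" "X = blk 0 S" using IN by blast
    then show "X \<in> radical_ideal P"
      using Nsym unit P_iff by (auto simp: radical_ideal_def)
  next
    fix X assume "X \<in> radical_ideal P"
    then obtain S where S: "X = blk 0 S" "transpose S = S" "\<And>a b. S $ a $ b \<noteq> 0 \<Longrightarrow> (r a, r b) \<in> P"
      by (auto simp: radical_ideal_def)
    have "matrix_scale (S $ a $ b / 2) (sym_unit a b) \<in> N" for a b
    proof (cases "S $ a $ b = 0")
      case True
      then show ?thesis using Nsub by (simp add: cmat.subspace_0)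
    qed (use S(3) P_iff Nsub in \<open>blast intro: cmat.subspace_scale\<close>)
    then have "S \<in> N"
      by (subst symmetric_expansion[OF S(2)]) (intro cmat.subspace_sum[OF Nsub])
    then show "X \<in> I" using S(1) by (simp add: N_def)
  qed
  ultimately show ?thesis by blast
qed

lemma radical_ideal_subspace: "cmat.subspace (radical_ideal P)"
proof (rule cmat.subspaceI)
  show "0 \<in> radical_ideal P"
    unfolding radical_ideal_def by (auto intro!: exI[of _ 0])
next
  fix X Y assume "X \<in> radical_ideal P" "Y \<in> radical_ideal P"
  then obtain S T where "X = blk 0 S" "Y = blk 0 T" "transpose S = S" "transpose T = T"
    "\<And>a b. S $ a $ b \<noteq> 0 \<Longrightarrow> (r a, r b) \<in> P" "\<And>a b. T $ a $ b \<noteq> 0 \<Longrightarrow> (r a, r b) \<in> P"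
    by (auto simp: radical_ideal_def)
  then show "X + Y \<in> radical_ideal P"
    unfolding radical_ideal_def by (auto intro!: exI[of _ "S + T"] simp: blk_add transpose_add) force
next
  fix c X assume "X \<in> radical_ideal P"
  then obtain S where "X = blk 0 S" "transpose S = S" "\<And>a b. S $ a $ b \<noteq> 0 \<Longrightarrow> (r a, r b) \<in> P"
    by (auto simp: radical_ideal_def)
  then show "matrix_scale c X \<in> radical_ideal P"
    unfolding radical_ideal_def
    by (auto intro!: exI[of _ "matrix_scale c S"] simp: blk_scale transpose_matrix_scale)
       (simp add: matrix_scale_def)
qed

lemma radical_ideal_abelian:
  assumes P: "P \<in> sym_downsets CARD('n)"
  shows "abelian_ideal (radical_ideal P) std_borel"
  unfolding abelian_ideal_def lie_ideal_def
proof (intro conjI ballI)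
  show "cmat.subspace (radical_ideal P)" by (rule radical_ideal_subspace)
  show "radical_ideal P \<subseteq> std_borel"
    by (auto simp: radical_ideal_def blk_in_std_borel_iff upper_def)
next
  fix X Y assume "X \<in> std_borel" "Y \<in> radical_ideal P"
  then obtain A T S where X: "X = blk A T" "upper A" and Y: "Y = blk 0 S" "transpose S = S"
    and S: "\<And>a b. S $ a $ b \<noteq> 0 \<Longrightarrow> (r a, r b) \<in> P"
    by (auto simp: radical_ideal_def elim!: std_borelE)
  have "(r a, r b) \<in> P" if nz: "act A S $ a $ b \<noteq> 0" for a b
  proof -
    obtain c where "A $ a $ c * S $ c $ b + S $ a $ c * A $ b $ c \<noteq> 0"
      using nz unfolding act_nth by (meson sum.not_neutral_contains_not_neutral)
    then consider "A $ a $ c \<noteq> 0" "S $ c $ b \<noteq> 0" | "A $ b $ c \<noteq> 0" "S $ a $ c \<noteq> 0" by force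
    then show ?thesis
    proof cases
      case 1
      then have "r a \<le> r c" using X(2) by (force simp: upper_def not_less[symmetric])
      then show ?thesis using sym_downsetsD(3)[OF P S[OF 1(2)]] by blast
    next
      case 2
      then have "r b \<le> r c" using X(2) by (force simp: upper_def not_less[symmetric])
      then show ?thesis
        using sym_downsetsD(2)[OF P] sym_downsetsD(3)[OF P sym_downsetsD(2)[OF P S[OF 2(2)]]] by blast
    qed
  qed
  moreover have "lie_bracket X Y = blk 0 (act A S)"
    unfolding X Y by (simp add: lie_bracket_blk) (simp add: lie_bracket_def act_def)
  ultimately show "lie_bracket X Y \<in> radical_ideal P"
    using transpose_act[OF Y(2)] unfolding radical_ideal_def by blast
next
  fix X Y assume "X \<in> radical_ideal P" "Y \<in> radical_ideal P"
  then show "lie_bracket X Y = 0"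
    by (auto simp: radical_ideal_def lie_bracket_blk) (simp add: lie_bracket_def act_def)
qed

lemma blk_sym_unit_in_radical_ideal_iff:
  assumes P: "P \<in> sym_downsets CARD('n)"
  shows "blk 0 (sym_unit a b) \<in> radical_ideal P \<longleftrightarrow> (r a, r b) \<in> P"
proof
  assume "blk 0 (sym_unit a b) \<in> radical_ideal P"
  moreover have "sym_unit a b $ a $ b \<noteq> 0" by (simp add: sym_unit_nth_eq_0_iff)
  ultimately show "(r a, r b) \<in> P" unfolding radical_ideal_def by auto
next
  assume ab: "(r a, r b) \<in> P"
  then have "\<forall>k l. sym_unit a b $ k $ l \<noteq> 0 \<longrightarrow> (r k, r l) \<in> P"
    using sym_downsetsD(2)[OF P ab] by (auto simp: sym_unit_nth_eq_0_iff)
  then show "blk 0 (sym_unit a b) \<in> radical_ideal P"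
    unfolding radical_ideal_def using transpose_sym_unit by blast
qed

lemma inj_on_radical_ideal: "inj_on radical_ideal (sym_downsets CARD('n))"
proof (rule inj_onI)
  fix P Q assume P: "P \<in> sym_downsets CARD('n)" and Q: "Q \<in> sym_downsets CARD('n)"
    and eq: "radical_ideal P = radical_ideal Q"
  have "(i, j) \<in> P \<longleftrightarrow> (i, j) \<in> Q" for i j
  proof (cases "i < CARD('n) \<and> j < CARD('n)")
    case True
    then obtain a b where "i = r a" "j = r b" using r_surj by metis
    then show ?thesis
      using blk_sym_unit_in_radical_ideal_iff[OF P, of a b] blk_sym_unit_in_radical_ideal_iff[OF Q, of a b] eq
      by simp
  next
    case False
    then show ?thesis using sym_downsetsD(1)[OF P] sym_downsetsD(1)[OF Q] by blast
  qed
  then show "P = Q" by auto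
qed

lemma dim_radical_ideal:
  assumes P: "P \<in> sym_downsets CARD('n)"
  shows "cmat.dim (radical_ideal P) = weight P"
proof (rule cmat.dim_unique)
  define K where "K = {(a, b). (r a, r b) \<in> P \<and> r a \<le> r b}"
  define u where "u p = blk 0 (sym_unit (fst p) (snd p))" for p :: "'n \<times> 'n"
  have entry: "u p $ Inl a $ Inr b = (if p = (a, b) then (if a = b then 2 else 1) else 0)"
    if "p \<in> K" "(a, b) \<in> K" for p a b
  proof -
    have "a = fst p \<and> b = snd p \<longleftrightarrow> p = (a, b)" "a = snd p \<and> b = fst p \<longleftrightarrow> p = (a, b) \<and> a = b"
      using that by (auto simp: K_def prod_eq_iff)
    then have "u p $ Inl a $ Inr b
        = (if p = (a, b) then 1 else 0) + (if p = (a, b) \<and> a = b then 1 else 0)"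
      by (simp only: u_def blk_nth sym_unit_nth)
    then show ?thesis by (cases "p = (a, b)"; cases "a = b") simp_all
  qed
  have inj: "inj_on u K"
  proof (rule inj_onI)
    fix p q assume pq: "p \<in> K" "q \<in> K" "u p = u q"
    obtain a b where q: "q = (a, b)" by (cases q)
    have "u p $ Inl a $ Inr b \<noteq> 0" using entry[of q a b] pq q by auto
    then show "p = q" using entry[of p a b] pq q by (auto split: if_splits)
  qed
  have fin: "finite K" by simp
  show "u ` K \<subseteq> radical_ideal P"
    using blk_sym_unit_in_radical_ideal_iff[OF P] by (auto simp: u_def K_def)
  show "cmat.independent (u ` K)"
  proof (rule cmat.independent_if_scalars_zero)
    fix f x assume 0: "(\<Sum>x\<in>u ` K. matrix_scale (f x) x) = 0" and "x \<in> u ` K"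
    then obtain a b where ab: "(a, b) \<in> K" "x = u (a, b)" by auto
    have "0 = (\<Sum>p\<in>K. matrix_scale (f (u p)) (u p)) $ Inl a $ Inr b"
      using 0 by (simp add: sum.reindex[OF inj])
    also have "\<dots> = (\<Sum>p\<in>K. f (u p) * u p $ Inl a $ Inr b)"
      by (simp add: sum_component matrix_scale_def)
    also have "\<dots> = (\<Sum>p\<in>K. if p = (a, b) then f x * (if a = b then 2 else 1) else 0)"
      by (rule sum.cong[OF refl]) (auto simp: entry ab)
    also have "\<dots> = f x * (if a = b then 2 else 1)" using ab fin by simp
    finally show "f x = 0" by (auto split: if_splits)
  qed simp
  show "radical_ideal P \<subseteq> cmat.span (u ` K)"
  proof
    fix X assume "X \<in> radical_ideal P"
    then obtain S where S: "X = blk 0 S" "transpose S = S" "\<And>a b. S $ a $ b \<noteq> 0 \<Longrightarrow> (r a, r b) \<in> P"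
      by (auto simp: radical_ideal_def)
    have sub: "cmat.subspace {T. blk 0 T \<in> cmat.span (u ` K)}"
    proof (rule cmat.subspaceI, simp_all add: cmat.span_zero)
      fix T T' assume "blk 0 T \<in> cmat.span (u ` K)" "blk 0 T' \<in> cmat.span (u ` K)"
      from cmat.span_add[OF this] show "blk 0 (T + T') \<in> cmat.span (u ` K)" by (simp add: blk_add)
    next
      fix c T assume "blk 0 T \<in> cmat.span (u ` K)"
      from cmat.span_scale[OF this, of c] show "blk 0 (matrix_scale c T) \<in> cmat.span (u ` K)"
        by (simp add: blk_scale)
    qed
    have "sym_unit a b \<in> {T. blk 0 T \<in> cmat.span (u ` K)}" if "S $ a $ b \<noteq> 0" for a b
    proof -
      have "(a, b) \<in> K \<or> (b, a) \<in> K"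
        using S(3)[OF that] sym_downsetsD(2)[OF P S(3)[OF that]] by (auto simp: K_def)
      then have "blk 0 (sym_unit a b) \<in> u ` K"
        by (auto simp: u_def image_iff) (metis sym_unit_commute fst_conv snd_conv)+
      then show ?thesis by (simp add: cmat.span_base)
    qed
    then have "matrix_scale (S $ a $ b / 2) (sym_unit a b) \<in> {T. blk 0 T \<in> cmat.span (u ` K)}" for a b
      using cmat.subspace_scale[OF sub] cmat.subspace_0[OF sub] by (cases "S $ a $ b = 0") auto
    then have "S \<in> {T. blk 0 T \<in> cmat.span (u ` K)}"
      by (subst symmetric_expansion[OF S(2)]) (intro cmat.subspace_sum[OF sub])
    then show "X \<in> cmat.span (u ` K)" using S(1) by simp
  qed
  have "map_prod r r ` K = {(i, j) \<in> P. i \<le> j}"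
  proof -
    have "(i, j) \<in> map_prod r r ` K" if ij: "(i, j) \<in> P" "i \<le> j" for i j
    proof -
      obtain a b where "i = r a" "j = r b" using sym_downsetsD(1)[OF P ij(1)] r_surj by metis
      then show ?thesis using ij by (force simp: K_def)
    qed
    then show ?thesis by (auto simp: K_def)
  qed
  moreover have "inj_on (map_prod r r) K" by (auto simp: inj_on_def)
  ultimately have "weight P = card K"
    unfolding weight_def using card_image[of "map_prod r r" K] by simp
  then show "card (u ` K) = weight P" using card_image[OF inj] by simp
qed

lemma abelian_ideals_std_borel:
  "{I. abelian_ideal I std_borel \<and> cmat.dim I = d} = radical_ideal ` {P \<in> sym_downsets CARD('n). weight P = d}"
proof (intro equalityI subsetI)
  fix I assume "I \<in> {I. abelian_ideal I std_borel \<and> cmat.dim I = d}"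
  then have I: "abelian_ideal I std_borel" "cmat.dim I = d" by auto
  obtain P where "P \<in> sym_downsets CARD('n)" "I = radical_ideal P"
    using abelian_ideal_imp_radical_ideal[OF I(1)] by blast
  then show "I \<in> radical_ideal ` {P \<in> sym_downsets CARD('n). weight P = d}"
    using dim_radical_ideal I(2) by auto
next
  fix I assume "I \<in> radical_ideal ` {P \<in> sym_downsets CARD('n). weight P = d}"
  then obtain P where "P \<in> sym_downsets CARD('n)" "weight P = d" "I = radical_ideal P" by auto
  then show "I \<in> {I. abelian_ideal I std_borel \<and> cmat.dim I = d}"
    using radical_ideal_abelian dim_radical_ideal by simp
qed

end

theorem mainTheorem2:
  fixes B :: "(complex ^ ('n::finite + 'n) ^ ('n + 'n)) set" and i :: nat
  assumes "borel_subalgebra B sp_algebra"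
  shows "finite {I. abelian_ideal I B \<and> cmat.dim I = i} \<and>
    card {I. abelian_ideal I B \<and> cmat.dim I = i} =
      coeff (\<Prod>j = 1..CARD('n). 1 + monom (1::nat) j) i"
proof -
  obtain r :: "'n \<Rightarrow> nat" where "bij_betw r UNIV {0..<CARD('n)}"
    using ex_bij_betw_finite_nat[OF finite[of "UNIV :: 'n set"]] by blast
  then interpret index_order r by unfold_locales (simp add: atLeast0LessThan)
  obtain g where g: "symplectic g" "B = conjugate g ` std_borel"
    using borel_conjugate[OF assms] by blast
  let ?D = "{P \<in> sym_downsets CARD('n). weight P = i}"
  have eq: "{I. abelian_ideal I B \<and> cmat.dim I = i} = (`) (conjugate g) ` radical_ideal ` ?D"
    unfolding g(2) conjugate_abelian_ideals_eq[OF g(1)] abelian_ideals_std_borel ..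
  have "inj_on ((`) (conjugate g)) (radical_ideal ` ?D)"
    by (rule inj_on_subset[OF inj_on_image_Pow[OF conjugate_inj[OF g(1)]]]) simp
  moreover have "inj_on radical_ideal ?D"
    by (rule inj_on_subset[OF inj_on_radical_ideal]) blast
  ultimately have "card {I. abelian_ideal I B \<and> cmat.dim I = i} = card ?D"
    unfolding eq by (simp add: card_image)
  moreover have "finite {I. abelian_ideal I B \<and> cmat.dim I = i}"
    unfolding eq by (simp add: finite_sym_downsets)
  ultimately show ?thesis by (simp add: card_sym_downsets_of_weight)
qed

end
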